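(* Let $\tau>0$, $\alpha>0$, let $\theta$ be a constant contact angle, and let $\Gamma_h^0,\dots,\Gamma_h^N\subset\mathbb{R}^3$ be open discrete surfaces with boundary (contact line) in the plane $\mathbb{R}^2\times\{0\}$ such that for each $m=1,\dots,N$ one has $\Gamma_h^m=X_h^m(\Gamma_h^{m-1})$ with $X_h^m=\mathrm{id}+\tau v_h^m$, where $(v_h^m,\lambda_h^m,c^m)\in\mathbf{X}_h^{m-1}\times S_h^{m-1}\times\mathbb{R}$ is the solution of $$\int_{\Gamma_h^{m-1}}\nabla_{\Gamma_h^{m-1}}(\tau v_h^m+\mathrm{id})\cdot\nabla_{\Gamma_h^{m-1}}\eta_h-(\lambda_h^m n_h^{m-1},\eta_h)^{(h)}-c^m(T_h^{m-1},\eta_h)^{(h)}=\int_{\partial\Gamma_h^{m-1}}\cos\theta\; n_{\partial,h}^{m-\frac12}\cdot\eta_h\quad\forall\eta_h\in\mathbf{X}_h^{m-1},$$ $$(v_h^m\cdot n_h^{m-1},\chi_h)^{(h)}+\int_{\Gamma_h^{m-1}}\nabla_{\Gamma_h^{m-1}}\lambda_h^m\cdot\nabla_{\Gamma_h^{m-1}}\chi_h=0\quad\forall\chi_h\in S_h^{m-1},$$ $$(v_h^m,T_h^{m-1})^{(h)}+\alpha c^m\|T_h^{m-1}\|_{L^2_h}=0,$$ with $$n_{\partial,h}^{m-\frac12}=\tfrac12\bigl(\partial_s X_h^{m-1}+\partial_s X_h^m\bigr)\times e_3\quad\text{on }\partial\Gamma_h^{m-1},\qquad X_h^{m-1}:=\mathrm{id}\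 \text{ on }\partial\Gamma_h^{m-1},$$ $s$ being arc length on $\partial\Gamma_h^{m-1}$. Then the discrete surface energy $$W_h^m:=|\Gamma_h^m|-\cos\theta\,|S_1^m|$$ is non-increasing over time, i.e. $W_h^m\le W_h^{m-1}$ for $m=1,2,\dots,N$. Here $|\Gamma_h^m|$ is the area of $\Gamma_h^m$ and $|S_1^m|$ is the area of the discrete film-substrate interface $S_1^m$.
   Context: Each $\Gamma_h^{m-1}$ is an oriented polyhedral surface in $\mathbb{R}^3$: a finite union of nondegenerate flat triangles meeting conformingly, with boundary $\partial\Gamma_h^{m-1}$ a simple closed polygonal curve contained in the plane $\mathbb{R}^2\times\{0\}$ (the substrate). The triangles (resp. boundary edges) of $\Gamma_h^m$ are the images under the piecewise linear map $X_h^m$ of those of $\Gamma_h^{m-1}$, and $|\Gamma_h^m|$ is the sum of the areas of its triangles. The boundary curves are parametrized consistently through the maps $X_h^m$ and positively oriented (counterclockwise in the plane), so that $\partial_s\mathrm{id}\times e_3$ is the outward normal within the substrate plane; $e_3=(0,0,1)^T$. $S_1^m$ is the flat region of $\mathbb{R}^2\times\{0\}$ enclosed by $\partial\Gamma_h^m$. $S_h^{m-1}$ is the space of continuous real functions on $\Gamma_h^{m-1}$ that are linear (affine) on each triangle; $\mathring S_h(\Gamma_h^{m-1})$ is its subspace of functions vanishing on $\partial\Gamma_h^{m-1}$, and $\mathbf{X}_h^{m-1}=S_h^{m-1}\times S_h^{m-1}\times\mathring S_h(\Gamma_h^{m-1})$. $n_h^{m-1}$ is the piecewise constant unit normal of $\Gamma_h^{m-1}$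 (consistently oriented). $\mathrm{id}$ is the identity map of $\Gamma_h^{m-1}$; $\nabla_{\Gamma_h^{m-1}}$ is the elementwise tangential gradient, acting componentwise on vector fields, and $\cdot$ between gradients of vector fields is the Frobenius product. Mass lumping on $\Gamma_h^{m-1}$: for functions $\eta,\chi$ continuous on each triangle (possibly jumping across edges), $$(\eta,\chi)^{(h)}=\frac13\sum_{l}|\sigma_l|\sum_{k=1}^3(\eta\cdot\chi)\bigl((\vec q_{l,k})^-\bigr),$$ where $\sigma_l$ runs over the (relatively open) triangles, $|\sigma_l|$ is the area, $\vec q_{l,k}$ are the vertices of $\sigma_l$, and $(\vec q_{l,k})^-$ denotes the limit from inside $\sigma_l$; for vector arguments the product is the Euclidean inner product. $\|f\|_{L^2_h}=\sqrt{(f,f)^{(h)}}$. $\int_{\partial\Gamma_h^{m-1}}^{(h)}$ denotes the analogous mass-lumped (edgewise trapezoidal) quadrature on the polygonal curve $\partial\Gamma_h^{m-1}$. Definition of $T_h^{m-1}$: let $n_{\partial,h}^{m-1}$ be the piecewise constant unit normal of $\partial\Gamma_h^{m-1}$ within the substrate plane, and let $\nu_h^{m-1}\in (S_h^{m-1})^3$ be the Riesz representative given by $$(\nu_h^{m-1},\eta_h)^{(h)}=\int_{\Gamma_h^{m-1}}\nabla_{\Gamma_h^{m-1}}\mathrm{id}\cdot\nabla_{\Gamma_h^{m-1}}\eta_h-\int_{\partial\Gamma_h^{m-1}}^{(h)}\cos\theta\,n_{\partial,h}^{m-1}\cdot\eta_h-\int_{\partial\Gamma_h^{m-1}}^{(h)}\sin\theta\,e_3\cdot\eta_h\quad\forall\eta_h\in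 (S_h^{m-1})^3.$$ Then $T_h^{m-1}\in (S_h^{m-1})^3$ is determined by finding $(T_h^{m-1},\mu_h)\in (S_h^{m-1})^3\times S_h^{m-1}$ with $$(T_h^{m-1},\eta_h)^{(h)}+(\mu_h n_h^{m-1},\eta_h)^{(h)}=(\nu_h^{m-1},\eta_h)^{(h)}\quad\forall\eta_h\in (S_h^{m-1})^3,$$ $$(T_h^{m-1},n_h^{m-1}\chi_h)^{(h)}=0\quad\forall\chi_h\in S_h^{m-1}.$$ *)

theory Defs
  imports "HOL-Analysis.Analysis"
begin

section \<open>Oriented polyhedral surfaces over the substrate plane\<close>

text \<open>
  A discrete surface is given by its (closed) triangles, a unit normal for each triangle, and the
  cyclic list of the vertices of its boundary polygon in the order of traversal. The list fixes the
  direction of the arc length on the boundary.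
\<close>

record polysurf =
  tris :: "(real^3) set set"
  nrm :: "(real^3) set \<Rightarrow> real^3"
  bverts :: "(real^3) list"

definition carrier_surf :: "polysurf \<Rightarrow> (real^3) set" where
  "carrier_surf M = \<Union>(tris M)"

definition bedges :: "polysurf \<Rightarrow> ((real^3) \<times> (real^3)) list" where
  "bedges M = zip (bverts M) (rotate1 (bverts M))"

definition bd_surf :: "polysurf \<Rightarrow> (real^3) set" where
  "bd_surf M = (\<Union>(p, q)\<in>set (bedges M). closed_segment p q)"

fun polyline :: "'a::real_normed_vector list \<Rightarrow> real \<Rightarrow> 'a" where
  "polyline [] = linepath 0 0"
| "polyline [a] = linepath a a"
| "polyline [a, b] = linepath a b"
| "polyline (a # b # c # xs) = linepath a b +++ polyline (b # c # xs)"

abbreviation e3 :: "real^3" where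
  "e3 \<equiv> axis 3 1"

definition bd_normal :: "real^3 \<Rightarrow> real^3 \<Rightarrow> real^3" where
  "bd_normal p q = cross3 ((q - p) /\<^sub>R dist p q) e3"

text \<open>
  The substrate plane is identified with \<open>real \<times> real\<close>, so that the region enclosed by
  the boundary polygon is its \<^const>\<open>inside\<close> there (in \<open>real^3\<close> a curve encloses nothing).
\<close>

definition plane_pr :: "real^3 \<Rightarrow> real \<times> real" where
  "plane_pr x = (x $ 1, x $ 2)"

definition substrate_region :: "polysurf \<Rightarrow> (real \<times> real) set" where
  "substrate_region M = inside (plane_pr ` bd_surf M)"

text \<open>Positive orientation: the normal \<open>\<partial>\<^sub>s id \<times> e3\<close> points out of the enclosed region.\<close>

definition positively_oriented_bd :: "polysurf \<Rightarrow> bool" where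
  "positively_oriented_bd M \<longleftrightarrow>
     (\<forall>(p, q)\<in>set (bedges M). \<forall>x\<in>open_segment p q.
        \<forall>\<^sub>F \<epsilon> in at_right 0.
          plane_pr (x + \<epsilon> *\<^sub>R bd_normal p q) \<in> outside (plane_pr ` bd_surf M) \<and>
          plane_pr (x - \<epsilon> *\<^sub>R bd_normal p q) \<in> substrate_region M)"

definition surface_with_boundary :: "(real^3) set \<Rightarrow> bool" where
  "surface_with_boundary S \<longleftrightarrow>
     (\<forall>x\<in>S. \<exists>U V. openin (top_of_set S) U \<and> x \<in> U \<and>
        openin (top_of_set {y :: real \<times> real. 0 \<le> snd y}) V \<and> U homeomorphic V)"

text \<open>
  Consistency of the normals: triangles that share an edge induce opposite directions on it.
\<close>

definition oriented_normals :: "polysurf \<Rightarrow> bool" where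
  "oriented_normals M \<longleftrightarrow>
     (\<forall>\<sigma>\<in>tris M. norm (nrm M \<sigma>) = 1 \<and> (\<forall>x\<in>\<sigma>. \<forall>y\<in>\<sigma>. nrm M \<sigma> \<bullet> (y - x) = 0)) \<and>
     (\<forall>p q a b. convex hull {p, q, a} \<in> tris M \<and> convex hull {p, q, b} \<in> tris M \<and> a \<noteq> b \<longrightarrow>
        (cross3 (q - p) (a - p) \<bullet> nrm M (convex hull {p, q, a})) *
        (cross3 (q - p) (b - p) \<bullet> nrm M (convex hull {p, q, b})) < 0)"

definition polyhedral_surface :: "polysurf \<Rightarrow> bool" where
  "polyhedral_surface M \<longleftrightarrow>
     triangulation (tris M) \<and> (\<forall>\<sigma>\<in>tris M. 2 simplex \<sigma>) \<and>
     surface_with_boundary (carrier_surf M) \<and>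
     oriented_normals M \<and>
     3 \<le> length (bverts M) \<and>
     {e. \<exists>!\<sigma>. \<sigma> \<in> tris M \<and> e edge_of \<sigma>} = (\<lambda>(p, q). closed_segment p q) ` set (bedges M) \<and>
     simple_path (polyline (bverts M @ [hd (bverts M)])) \<and>
     (\<forall>p\<in>set (bverts M). p $ 3 = 0) \<and>
     positively_oriented_bd M"


section \<open>Areas and integrals\<close>

definition corners :: "(real^3) set \<Rightarrow> (real^3) \<times> (real^3) \<times> (real^3)" where
  "corners \<sigma> = (SOME (a, b, c). \<sigma> = convex hull {a, b, c})"

definition tri_area :: "(real^3) set \<Rightarrow> real" where
  "tri_area \<sigma> = (case corners \<sigma> of (a, b, c) \<Rightarrow> norm (cross3 (b - a) (c - a)) / 2)"

definition tri_integral :: "(real^3) set \<Rightarrow> (real^3 \<Rightarrow> real) \<Rightarrow> real" where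
  "tri_integral \<sigma> f = (case corners \<sigma> of (a, b, c) \<Rightarrow>
     norm (cross3 (b - a) (c - a)) *
     integral {(s, t). 0 \<le> s \<and> 0 \<le> t \<and> s + t \<le> (1::real)}
       (\<lambda>(s, t). f (a + s *\<^sub>R (b - a) + t *\<^sub>R (c - a))))"

text \<open>
  Elementwise defined integrands, which are two-valued on interior edges, take the triangle as an
  additional argument.
\<close>

definition surf_integral :: "polysurf \<Rightarrow> ((real^3) set \<Rightarrow> real^3 \<Rightarrow> real) \<Rightarrow> real" where
  "surf_integral M f = (\<Sum>\<sigma>\<in>tris M. tri_integral \<sigma> (f \<sigma>))"

definition surf_area :: "polysurf \<Rightarrow> real" where
  "surf_area M = (\<Sum>\<sigma>\<in>tris M. tri_area \<sigma>)"

definition surf_energy :: "real \<Rightarrow> polysurf \<Rightarrow> real" where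
  "surf_energy \<theta> M = surf_area M - cos \<theta> * measure lebesgue (substrate_region M)"

definition lump :: "polysurf \<Rightarrow> (real^3 \<Rightarrow> 'a::real_inner) \<Rightarrow> (real^3 \<Rightarrow> 'a) \<Rightarrow> real" where
  "lump M \<eta> \<xi> = 1/3 * (\<Sum>\<sigma>\<in>tris M. tri_area \<sigma> *
     (\<Sum>q | q extreme_point_of \<sigma>. Lim (at q within rel_interior \<sigma>) (\<lambda>x. \<eta> x \<bullet> \<xi> x)))"

definition lump_norm :: "polysurf \<Rightarrow> (real^3 \<Rightarrow> 'a::real_inner) \<Rightarrow> real" where
  "lump_norm M f = sqrt (lump M f f)"

text \<open>
  On the boundary, functions depend on the directed edge from \<open>p\<close> to \<open>q\<close>, and on the arc length
  \<open>s \<in> {0..dist p q}\<close> along it (\<open>bd_integral\<close>) or on the point (\<open>bd_lumped\<close>).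
\<close>

definition arc_pt :: "real^3 \<Rightarrow> real^3 \<Rightarrow> real \<Rightarrow> real^3" where
  "arc_pt p q s = p + (s / dist p q) *\<^sub>R (q - p)"

definition ds :: "(real^3 \<Rightarrow> real^3) \<Rightarrow> real^3 \<Rightarrow> real^3 \<Rightarrow> real \<Rightarrow> real^3" where
  "ds X p q s = vector_derivative (\<lambda>r. X (arc_pt p q r)) (at s within {0..dist p q})"

definition bd_integral :: "polysurf \<Rightarrow> (real^3 \<Rightarrow> real^3 \<Rightarrow> real \<Rightarrow> real) \<Rightarrow> real" where
  "bd_integral M f = (\<Sum>(p, q)\<leftarrow>bedges M. integral {0..dist p q} (f p q))"

definition bd_lumped :: "polysurf \<Rightarrow> (real^3 \<Rightarrow> real^3 \<Rightarrow> real^3 \<Rightarrow> real) \<Rightarrow> real" where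
  "bd_lumped M f = (\<Sum>(p, q)\<leftarrow>bedges M. dist p q / 2 * (f p q p + f p q q))"

definition mid_normal ::
  "(real^3 \<Rightarrow> real^3) \<Rightarrow> real^3 \<Rightarrow> real^3 \<Rightarrow> real \<Rightarrow> real^3" where
  "mid_normal X p q s = cross3 ((1/2) *\<^sub>R (ds id p q s + ds X p q s)) e3"


section \<open>Finite element spaces, normal field and tangential gradient\<close>

text \<open>Functions on the surface are total functions whose values off the surface are irrelevant.\<close>

definition S_h :: "polysurf \<Rightarrow> (real^3 \<Rightarrow> real) set" where
  "S_h M = {f. continuous_on (carrier_surf M) f \<and>
     (\<forall>\<sigma>\<in>tris M. \<exists>A b. linear A \<and> (\<forall>x\<in>\<sigma>. f x = A x + b))}"

definition S_h0 :: "polysurf \<Rightarrow> (real^3 \<Rightarrow> real) set" where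
  "S_h0 M = {f \<in> S_h M. \<forall>x\<in>bd_surf M. f x = 0}"

definition S_h_vec :: "polysurf \<Rightarrow> (real^3 \<Rightarrow> real^3) set" where
  "S_h_vec M = {v. \<forall>i. (\<lambda>x. v x $ i) \<in> S_h M}"

definition X_h :: "polysurf \<Rightarrow> (real^3 \<Rightarrow> real^3) set" where
  "X_h M = {v. (\<lambda>x. v x $ 1) \<in> S_h M \<and> (\<lambda>x. v x $ 2) \<in> S_h M \<and> (\<lambda>x. v x $ 3) \<in> S_h0 M}"

definition n_h :: "polysurf \<Rightarrow> real^3 \<Rightarrow> real^3" where
  "n_h M x = nrm M (THE \<sigma>. \<sigma> \<in> tris M \<and> x \<in> rel_interior \<sigma>)"

definition tgrad :: "(real^3) set \<Rightarrow> (real^3 \<Rightarrow> real) \<Rightarrow> real^3 \<Rightarrow> real^3" where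
  "tgrad \<sigma> f x = (THE g. g \<in> span ((\<lambda>y. y - x) ` \<sigma>) \<and>
     (f has_derivative (\<lambda>h. g \<bullet> h)) (at x within \<sigma>))"

definition grad_dot :: "polysurf \<Rightarrow> (real^3 \<Rightarrow> real) \<Rightarrow> (real^3 \<Rightarrow> real) \<Rightarrow> real" where
  "grad_dot M f g = surf_integral M (\<lambda>\<sigma> x. tgrad \<sigma> f x \<bullet> tgrad \<sigma> g x)"

definition grad_dot_vec :: "polysurf \<Rightarrow> (real^3 \<Rightarrow> real^3) \<Rightarrow> (real^3 \<Rightarrow> real^3) \<Rightarrow> real" where
  "grad_dot_vec M u w = surf_integral M (\<lambda>\<sigma> x.
     \<Sum>i\<in>UNIV. tgrad \<sigma> (\<lambda>y. u y $ i) x \<bullet> tgrad \<sigma> (\<lambda>y. w y $ i) x)"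


section \<open>The discrete field \<open>T_h\<close>\<close>

text \<open>
  These are predicates, since the fields are determined only as functions on the surface and not
  as total functions.
\<close>

definition is_nu_h :: "polysurf \<Rightarrow> real \<Rightarrow> (real^3 \<Rightarrow> real^3) \<Rightarrow> bool" where
  "is_nu_h M \<theta> \<nu> \<longleftrightarrow> \<nu> \<in> S_h_vec M \<and>
     (\<forall>\<eta>\<in>S_h_vec M.
        lump M \<nu> \<eta> = grad_dot_vec M id \<eta>
          - bd_lumped M (\<lambda>p q x. cos \<theta> * (bd_normal p q \<bullet> \<eta> x))
          - bd_lumped M (\<lambda>p q x. sin \<theta> * (e3 \<bullet> \<eta> x)))"

definition is_T_h :: "polysurf \<Rightarrow> real \<Rightarrow> (real^3 \<Rightarrow> real^3) \<Rightarrow> bool" where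
  "is_T_h M \<theta> T \<longleftrightarrow> T \<in> S_h_vec M \<and>
     (\<exists>\<nu> \<mu>. is_nu_h M \<theta> \<nu> \<and> \<mu> \<in> S_h M \<and>
        (\<forall>\<eta>\<in>S_h_vec M. lump M T \<eta> + lump M (\<lambda>x. \<mu> x *\<^sub>R n_h M x) \<eta> = lump M \<nu> \<eta>) \<and>
        (\<forall>\<xi>\<in>S_h M. lump M T (\<lambda>x. \<xi> x *\<^sub>R n_h M x) = 0))"

end

theory Submission
  imports Defs
begin

text \<open>
  Test the momentum equation with the velocity \<open>v\<close> and the diffusion equation with \<open>\<lambda>\<close>.
  The two lumped pairings of \<open>\<lambda> n\<close> and \<open>v\<close> cancel and leave the Dirichlet energy of \<open>\<lambda>\<close>, and the
  constraint on \<open>c\<close> turns the \<open>T\<close>-term into \<open>\<alpha> c\<^sup>2 \<parallel>T\<parallel>\<close>. Both are nonnegative, so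
  the pairing of \<open>\<nabla>X\<close> with \<open>\<nabla>v\<close> is at most the boundary integral. Multiplied by \<open>\<tau>\<close>, the two sides
  of this inequality are compared with the two parts of the energy.

  \<^item> Left side (\<open>area_increment\<close>). On one triangle \<open>X\<close> is affine with linear part \<open>L\<close>, and
    \<open>\<tau> \<nabla>v = \<nabla>X - \<nabla>id\<close>. In an orthonormal frame \<open>e, f\<close> of the triangle,
    \<open>\<nabla>X \<cdot> (\<nabla>X - \<nabla>id) \<ge> (\<bar>L e\<bar>\<^sup>2 + \<bar>L f\<bar>\<^sup>2) / 2 - 1 \<ge> \<bar>L e \<times> L f\<bar> - 1\<close>, and \<open>\<bar>L e \<times> L f\<bar>\<close> is the factor by
    which \<open>X\<close> changes the area. Hence the left side bounds the growth of the surface area.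

  \<^item> Right side (\<open>boundary_work\<close>). It equals \<open>cos \<theta>\<close> times the change of the substrate area. By the
    shoelace formula the area is a quadratic form in the vertices of the boundary polygon. A quadratic
    form changes by its polar form at the midpoint applied to the increment, and that is the
    integral over the boundary of the midpoint normal against the displacement, up to terms that
    telescope around the closed polygon.

  The geometric work lies in the shoelace formula (\<open>polygon_region_area\<close>) for the region
  enclosed by the polygon in the sense of the topological \<open>inside\<close>. The region is cut by vertical
  lines. On a line that avoids the vertices, membership in the region jumps only where the line crosses
  an edge, and the positive orientation says in which direction it jumps. So the length of the slice is a
  signed sum of the heights at which the line crosses the edges, and Fubini's theorem integrates
  these heights edge by edge.
\<close>

section \<open>Sets on the line determined by their jumps\<close>

text \<open>
  The punctured limit \<open>k z\<close> of \<open>h\<close> at \<open>z\<close> is a locally constant function of \<open>z\<close>, hence constant.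
  Punctured neighbourhoods make isolated exceptional points of \<open>h\<close> harmless.
\<close>

lemma constant_of_punctured_limits:
  fixes h :: "real \<Rightarrow> 'b"
  assumes "\<And>z. \<exists>k. \<forall>\<^sub>F t in at z. h t = k"
  obtains K where "\<And>z. \<forall>\<^sub>F t in at z. h t = K"
proof -
  obtain k where k: "\<And>z. \<forall>\<^sub>F t in at z. h t = k z" using assms by metis
  have "k constant_on UNIV"
  proof (rule locally_constant_imp_constant)
    show "connected (UNIV :: real set)" by simp
    fix z :: real
    obtain S where S: "open S" "z \<in> S" "\<And>t. t \<in> S \<Longrightarrow> t \<noteq> z \<Longrightarrow> h t = k z"
      using k[of z] unfolding eventually_at_topological by auto
    have "k y = k z" if "y \<in> S" for y
    proof (cases "y = z")
      case False
      then have "\<forall>\<^sub>F t in at y. h t = k z"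
        unfolding eventually_at_topological using S that
        by (intro exI[of _ "S - {z}"]) (auto intro: open_delete)
      then have "\<forall>\<^sub>F t in at y. k y = k z"
        using k[of y] by eventually_elim simp
      then show ?thesis by simp
    qed simp
    then show "\<exists>T. openin (top_of_set UNIV) T \<and> z \<in> T \<and> (\<forall>x\<in>T. k x = k z)"
    proof (intro exI conjI)
      show "openin (top_of_set UNIV) S" unfolding openin_open using S(1) by blast
    qed (use S \<open>\<And>y. y \<in> S \<Longrightarrow> k y = k z\<close> in blast)+
  qed
  then obtain K where "\<And>z. k z = K" unfolding constant_on_def by auto
  then show thesis using k by (intro that[of K]) simp
qed

text \<open>
  A bounded set on the line is determined by its jumps: \<open>s i\<close> is the drop of the indicator at \<open>y i\<close>
  (left value minus right value). Subtracting the step functions with these drops leaves a function that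
  has punctured limits everywhere, so it is constant, and far to the right it vanishes.
\<close>

lemma jump_indicator:
  fixes U :: "real set" and y s :: "'i \<Rightarrow> real"
  assumes "finite E" and inj: "inj_on y E" and bdd: "bounded U"
    and off: "\<And>z. z \<notin> y ` E \<Longrightarrow> \<forall>\<^sub>F t in at z. t \<in> U \<longleftrightarrow> z \<in> U"
    and jump: "\<And>i. i \<in> E \<Longrightarrow>
      \<exists>k. \<forall>\<^sub>F t in at (y i). indicator U t - (if t < y i then s i else 0) = k"
    and z: "z \<notin> y ` E"
  shows "indicator U z = (\<Sum>i\<in>E. if z < y i then s i else 0)"
proof -
  define g where "g A t = (\<Sum>i\<in>A. if t < y i then s i else 0)" for A t
  define h where "h t = indicator U t - g E t" for t
  have g: "\<forall>\<^sub>F t in at x. g A t = g A x" if "finite A" "x \<notin> y ` A" for A x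
  proof -
    have "\<forall>\<^sub>F t in at x. \<forall>i\<in>A. (t < y i \<longleftrightarrow> x < y i)"
    proof (rule eventually_ball_finite[OF that(1)], rule ballI)
      fix i assume "i \<in> A"
      then have "x \<noteq> y i" using that by auto
      then consider "x < y i" | "x > y i" by linarith
      then show "\<forall>\<^sub>F t in at x. (t < y i \<longleftrightarrow> x < y i)"
      proof cases
        case 1
        then have "\<forall>\<^sub>F t in nhds x. t \<in> {..<y i}" by (intro eventually_nhds_in_open) auto
        then show ?thesis using 1 by (auto simp: eventually_at_filter elim: eventually_mono)
      next
        case 2
        then have "\<forall>\<^sub>F t in nhds x. t \<in> {y i<..}" by (intro eventually_nhds_in_open) auto
        then show ?thesis using 2 by (auto simp: eventually_at_filter elim: eventually_mono)
      qed
    qed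
    then show ?thesis unfolding g_def by eventually_elim (auto intro: sum.cong)
  qed
  have "\<exists>k. \<forall>\<^sub>F t in at x. h t = k" for x
  proof (cases "x \<in> y ` E")
    case False
    have "\<forall>\<^sub>F t in at x. h t = h x"
      using off[OF False] g[OF \<open>finite E\<close> False]
      by eventually_elim (auto simp: h_def indicator_def)
    then show ?thesis by blast
  next
    case True
    then obtain i where i: "i \<in> E" "x = y i" by auto
    obtain k where k: "\<forall>\<^sub>F t in at x. indicator U t - (if t < y i then s i else 0) = k"
      using jump[OF i(1)] i(2) by auto
    have n: "x \<notin> y ` (E - {i})" using i inj by (auto simp: inj_on_def)
    have "\<forall>\<^sub>F t in at x. h t = k - g (E - {i}) x"
      using k g[OF finite_Diff[OF \<open>finite E\<close>] n]
      by eventually_elim (auto simp: h_def g_def sum.remove[OF \<open>finite E\<close> i(1)])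
    then show ?thesis by blast
  qed
  then obtain K where K: "\<And>x. \<forall>\<^sub>F t in at x. h t = K"
    using constant_of_punctured_limits by metis
  obtain R where R: "\<And>x. x \<in> U \<Longrightarrow> \<bar>x\<bar> \<le> R" "\<And>i. i \<in> E \<Longrightarrow> \<bar>y i\<bar> \<le> R"
  proof -
    have "bounded (U \<union> y ` E)" using bdd \<open>finite E\<close> by (simp add: finite_imp_bounded)
    then show ?thesis using that unfolding bounded_iff by auto
  qed
  have loc: "h x = K" if "x \<notin> y ` E" for x
  proof -
    have "\<forall>\<^sub>F t in at x. h x = K"
      using off[OF that] g[OF \<open>finite E\<close> that] K[of x]
      by eventually_elim (auto simp: h_def indicator_def)
    then show ?thesis by simp
  qed
  \<comment> \<open>\<open>R + 1\<close> lies to the right of the set and of all jumps, which identifies the constant.\<close>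
  have RU: "R + 1 \<notin> U" using R(1)[of "R + 1"] by linarith
  have RE: "y i < R + 1" if "i \<in> E" for i using R(2)[OF that] by linarith
  have "R + 1 \<notin> y ` E" using RE by (metis imageE less_irrefl)
  moreover have "g E (R + 1) = 0" unfolding g_def
    by (intro sum.neutral ballI if_not_P) (use RE in \<open>simp add: not_less less_imp_le\<close>)
  ultimately have "K = 0" using loc[of "R+1"] RU by (simp add: h_def)
  then show ?thesis using loc[OF z] unfolding h_def g_def by linarith
qed

text \<open>
  Integrated form of the preceding lemma. The step function with drop \<open>s i\<close> at \<open>y i\<close> is
  not integrable on the whole line, so it is cut off at a level \<open>- B\<close> below the set.
\<close>

lemma jump_measure:
  fixes U :: "real set" and y s :: "'i \<Rightarrow> real"
  assumes "finite E" and inj: "inj_on y E" and bdd: "bounded U" and "open U"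
    and off: "\<And>z. z \<notin> y ` E \<Longrightarrow> \<forall>\<^sub>F t in at z. t \<in> U \<longleftrightarrow> z \<in> U"
    and jump: "\<And>i. i \<in> E \<Longrightarrow>
      \<exists>k. \<forall>\<^sub>F t in at (y i). indicator U t - (if t < y i then s i else 0) = k"
    and B: "\<And>i. i \<in> E \<Longrightarrow> - B \<le> y i" "U \<subseteq> {-B..}"
  shows "measure lborel U = (\<Sum>i\<in>E. s i * (y i + B))"
proof -
  have "measure lborel U = (\<integral>t. indicator U t \<partial>lborel)" by simp
  also have "\<dots> = (\<integral>t. (\<Sum>i\<in>E. s i * indicator {-B..y i} t) \<partial>lborel)"
  proof (rule integral_cong_AE)
    have "AE t in lborel. t \<notin> insert (-B) (y ` E)"
      using \<open>finite E\<close>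
      by (intro AE_not_in finite_imp_null_set_lborel) auto
    then show "AE t in lborel. indicator U t = (\<Sum>i\<in>E. s i * indicator {-B..y i} t)"
    proof eventually_elim
      case (elim t)
      then have t: "t \<noteq> - B" "t \<notin> y ` E" by auto
      show ?case
      proof (cases "t < -B")
        case True
        then show ?thesis using B(2) by (auto simp: indicator_def intro!: sum.neutral[symmetric])
      next
        case False
        have "indicator U t = (\<Sum>i\<in>E. if t < y i then s i else 0)"
          using jump_indicator[OF assms(1-3) off jump t(2)] by auto
        also have "\<dots> = (\<Sum>i\<in>E. s i * indicator {-B..y i} t)"
          using t False by (intro sum.cong) (auto simp: indicator_def)
        finally show ?thesis .
      qed
    qed
  next
    have "U \<in> sets lborel" using \<open>open U\<close> by simp
    then show "indicator U \<in> borel_measurable lborel" by (rule borel_measurable_indicator)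
    show "(\<lambda>t. \<Sum>i\<in>E. s i * indicator {-B..y i} t) \<in> borel_measurable lborel"
      by (intro borel_measurable_sum borel_measurable_times borel_measurable_const
          borel_measurable_indicator) simp
  qed
  also have "\<dots> = (\<Sum>i\<in>E. s i * (y i + B))"
  proof (subst Bochner_Integration.integral_sum)
    show "integrable lborel (\<lambda>t. s i * indicator {-B..y i} t)" for i
      by (intro integrable_mult_right integrable_real_indicator) (auto simp: emeasure_lborel_Icc_eq)
    show "(\<Sum>i\<in>E. \<integral>t. s i * indicator {-B..y i} t \<partial>lborel) = (\<Sum>i\<in>E. s i * (y i + B))"
      using B(1) by (intro sum.cong refl) simp
  qed
  finally show ?thesis .
qed

section \<open>The area enclosed by a positively oriented polygon\<close>

lemma connected_in_side:
  assumes "connected H" "H \<inter> C = {}" "w \<in> H"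
  shows "w \<in> inside C \<Longrightarrow> H \<subseteq> inside C" "w \<in> outside C \<Longrightarrow> H \<subseteq> outside C"
proof -
  have "connected_component (- C) w x" if "x \<in> H" for x
    using assms that unfolding connected_component_def by blast
  then show "w \<in> inside C \<Longrightarrow> H \<subseteq> inside C" "w \<in> outside C \<Longrightarrow> H \<subseteq> outside C"
    using inside_same_component outside_same_component by blast+
qed

text \<open>
  The orientation is given only along the normal through \<open>x\<close>. Near \<open>x\<close> the curve \<open>C\<close> lies in the
  hyperplane through \<open>x\<close> orthogonal to \<open>n\<close>, so each open half ball is a connected set off \<open>C\<close> and lies
  on the same side of \<open>C\<close> as its points on the normal.
\<close>

lemma sides_near_edge_point:
  fixes x n :: "'a::euclidean_space"
  assumes C: "C \<subseteq> K \<union> {w. (w - x) \<bullet> n = 0}" and K: "closed K" "x \<notin> K"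
    and n: "\<forall>\<^sub>F \<epsilon> in at_right 0. x + \<epsilon> *\<^sub>R n \<in> outside C \<and> x - \<epsilon> *\<^sub>R n \<in> inside C"
  shows "\<forall>\<^sub>F w in nhds x. ((w - x) \<bullet> n > 0 \<longrightarrow> w \<in> outside C) \<and> ((w - x) \<bullet> n < 0 \<longrightarrow> w \<in> inside C)"
proof -
  obtain \<delta> where \<delta>: "\<delta> > 0" "ball x \<delta> \<inter> K = {}"
    using K by (metis Compl_iff disjoint_eq_subset_Compl open_Compl open_contains_ball)
  have "((\<lambda>\<epsilon>. norm (\<epsilon> *\<^sub>R n)) \<longlongrightarrow> norm (0 *\<^sub>R n)) (at_right (0::real))"
    by (intro tendsto_intros)
  then have "\<forall>\<^sub>F \<epsilon> in at_right (0::real). norm (\<epsilon> *\<^sub>R n) < \<delta>"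
    by (rule order_tendstoD(2)) (use \<delta> in simp)
  moreover have "\<forall>\<^sub>F \<epsilon> in at_right (0::real). 0 < \<epsilon>" by (simp add: eventually_at_right_less)
  ultimately have "\<forall>\<^sub>F \<epsilon> in at_right 0. 0 < \<epsilon> \<and> norm (\<epsilon> *\<^sub>R n) < \<delta> \<and>
      x + \<epsilon> *\<^sub>R n \<in> outside C \<and> x - \<epsilon> *\<^sub>R n \<in> inside C"
    using n by eventually_elim auto
  then obtain \<epsilon> :: real where \<epsilon>: "0 < \<epsilon>" "norm (\<epsilon> *\<^sub>R n) < \<delta>"
      "x + \<epsilon> *\<^sub>R n \<in> outside C" "x - \<epsilon> *\<^sub>R n \<in> inside C"
    using eventually_happens'[OF trivial_limit_at_right_real] by blast
  have half: "convex (ball x \<delta> \<inter> {w. d < w \<bullet> m})" for d :: real and m :: 'a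
  proof (intro convex_Int convex_ball)
    show "convex {w. d < w \<bullet> m}" using convex_halfspace_gt[of d m] by (simp add: inner_commute)
  qed
  have "w \<in> outside C" if "w \<in> ball x \<delta>" "(w - x) \<bullet> n > 0" for w
  proof -
    let ?H = "ball x \<delta> \<inter> {w. x \<bullet> n < w \<bullet> n}"
    have "n \<noteq> 0" using that by auto
    then have "x + \<epsilon> *\<^sub>R n \<in> ?H" using \<epsilon> by (auto simp: dist_norm inner_add_left)
    moreover have "?H \<inter> C = {}" using C \<delta> by (auto simp: inner_diff_left)
    ultimately have "?H \<subseteq> outside C"
      using connected_in_side(2)[OF convex_connected[OF half]] \<epsilon> by blast
    then show ?thesis using that by (auto simp: inner_diff_left)
  qed
  moreover have "w \<in> inside C" if "w \<in> ball x \<delta>" "(w - x) \<bullet> n < 0" for w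
  proof -
    let ?H = "ball x \<delta> \<inter> {w. x \<bullet> (- n) < w \<bullet> (- n)}"
    have "n \<noteq> 0" using that by auto
    then have "x - \<epsilon> *\<^sub>R n \<in> ?H" using \<epsilon> by (auto simp: dist_norm inner_diff_left)
    moreover have "?H \<inter> C = {}" using C \<delta> by (auto simp: inner_diff_left)
    ultimately have "?H \<subseteq> inside C"
      using connected_in_side(1)[OF convex_connected[OF half]] \<epsilon> by blast
    then show ?thesis using that by (auto simp: inner_diff_left)
  qed
  ultimately show ?thesis
    using eventually_nhds_in_open[of "ball x \<delta>" x] \<delta>(1) by (auto elim!: eventually_mono)
qed

definition edge_height :: "real \<times> real \<Rightarrow> real \<times> real \<Rightarrow> real \<Rightarrow> real" where
  "edge_height p q x = snd p + (x - fst p) / (fst q - fst p) * (snd q - snd p)"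

lemma vertical_line_meets_segment:
  assumes "x \<noteq> fst p" "x \<noteq> fst q"
  shows "(x, t) \<in> closed_segment p q \<longleftrightarrow>
    x \<in> closed_segment (fst p) (fst q) \<and> t = edge_height p q x"
proof
  assume "(x, t) \<in> closed_segment p q"
  then obtain u where u: "0 \<le> u" "u \<le> 1" "x = (1 - u) * fst p + u * fst q"
      "t = (1 - u) * snd p + u * snd q"
    by (auto simp: in_segment prod_eq_iff)
  then have "fst p \<noteq> fst q" using assms by (auto simp: algebra_simps)
  then have "u = (x - fst p) / (fst q - fst p)" using u(3) by (simp add: field_simps)
  then have "edge_height p q x = snd p + u * (snd q - snd p)" by (simp add: edge_height_def)
  then have "t = edge_height p q x" using u(4) by (simp add: algebra_simps)
  moreover have "x \<in> closed_segment (fst p) (fst q)"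
    unfolding in_segment using u by (intro exI[of _ u]) simp
  ultimately show "x \<in> closed_segment (fst p) (fst q) \<and> t = edge_height p q x" by blast
next
  assume *: "x \<in> closed_segment (fst p) (fst q) \<and> t = edge_height p q x"
  then obtain u where u: "0 \<le> u" "u \<le> 1" "x = (1 - u) * fst p + u * fst q"
    by (auto simp: in_segment)
  then have "fst p \<noteq> fst q" using assms by (auto simp: algebra_simps)
  then have "u = (x - fst p) / (fst q - fst p)" using u(3) by (simp add: field_simps)
  then have "edge_height p q x = snd p + u * (snd q - snd p)" by (simp add: edge_height_def)
  then have "t = (1 - u) * snd p + u * snd q" using * by (simp add: algebra_simps)
  then have "(x, t) = (1 - u) *\<^sub>R p + u *\<^sub>R q" using u(3) by (simp add: prod_eq_iff)
  then show "(x, t) \<in> closed_segment p q"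
    unfolding in_segment using u by blast
qed

text \<open>
  For an edge above the level \<open>- B\<close>, this is the signed area of the trapezoid between them. It is
  positive when the edge runs to the left, that is, when a region on its left lies below it.
\<close>

lemma has_integral_edge_height:
  "has_bochner_integral lborel
     (\<lambda>x. sgn (fst p - fst q) * (edge_height p q x + B) * indicator (closed_segment (fst p) (fst q)) x)
     (- (fst q - fst p) * ((snd p + snd q) / 2 + B))"
proof -
  define m where "m = (snd q - snd p) / (fst q - fst p)"
  define k where "k = snd p - m * fst p + B"
  have eh: "edge_height p q x + B = m * x + k" for x
    by (simp add: edge_height_def m_def k_def diff_divide_distrib algebra_simps)
  have aff: "has_bochner_integral lborel (\<lambda>x. (m * x + k) * indicator {a..b} x)
      ((m * b\<^sup>2 / 2 + k * b) - (m * a\<^sup>2 / 2 + k * a))" if "a \<le> b" for a b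
    by (rule has_bochner_integral_FTC_Icc_real[OF that])
      (auto intro!: derivative_eq_intros continuous_intros)
  consider "fst p = fst q" | "fst p < fst q" | "fst p > fst q" by linarith
  then show ?thesis
  proof cases
    case 1
    then show ?thesis using has_bochner_integral_zero by simp
  next
    case 2
    have mm: "m * (fst q - fst p) = snd q - snd p" using 2 unfolding m_def by simp
    have "- (fst q - fst p) * ((snd p + snd q) / 2 + B) =
      - ((m * (fst q)\<^sup>2 / 2 + k * fst q) - (m * (fst p)\<^sup>2 / 2 + k * fst p))"
    proof -
      have "snd q = m * (fst q - fst p) + snd p" using mm by simp
      then show ?thesis by (subst (1) \<open>snd q = _\<close>) (simp add: k_def power2_eq_square field_simps)
    qed
    moreover have "(\<lambda>x. - ((m * x + k) * indicator {fst p..fst q} x)) = (\<lambda>x. sgn (fst p - fst q) *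
        (edge_height p q x + B) * indicator (closed_segment (fst p) (fst q)) x)"
      using 2 by (simp add: eh closed_segment_eq_real_ivl fun_eq_iff indicator_def)
    ultimately show ?thesis
      using has_bochner_integral_minus[OF aff[of "fst p" "fst q"]] 2 by simp
  next
    case 3
    have mm: "m * (fst q - fst p) = snd q - snd p" using 3 unfolding m_def by simp
    have "- (fst q - fst p) * ((snd p + snd q) / 2 + B) =
      ((m * (fst p)\<^sup>2 / 2 + k * fst p) - (m * (fst q)\<^sup>2 / 2 + k * fst q))"
    proof -
      have "snd q = m * (fst q - fst p) + snd p" using mm by simp
      then show ?thesis by (subst (1) \<open>snd q = _\<close>) (simp add: k_def power2_eq_square field_simps)
    qed
    then show ?thesis
      using aff[of "fst q" "fst p"] 3
      by (simp add: eh closed_segment_eq_real_ivl sgn_if)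
  qed
qed

text \<open>
  The normal \<open>r i * (\<Delta>y, - \<Delta>x)\<close> of an edge points outward. Its vertical component
  has the sign of \<open>fst (P i) - fst (Q i)\<close>, so crossing the edge upwards leaves the region if this is
  positive and enters it if it is negative. This is the jump that \<open>jump_measure\<close> needs.
\<close>

lemma slice_measure:
  fixes P Q :: "'i \<Rightarrow> real \<times> real" and r :: "'i \<Rightarrow> real"
  assumes J: "finite J"
    and C: "C = (\<Union>i\<in>J. closed_segment (P i) (Q i))"
    and r: "\<And>i. i \<in> J \<Longrightarrow> r i > 0"
    and orient: "\<And>i x. i \<in> J \<Longrightarrow> x \<in> open_segment (P i) (Q i) \<Longrightarrow>
      \<forall>\<^sub>F \<epsilon> in at_right 0.
        x + \<epsilon> *\<^sub>R r i *\<^sub>R (snd (Q i) - snd (P i), fst (P i) - fst (Q i)) \<in> outside C \<and>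
        x - \<epsilon> *\<^sub>R r i *\<^sub>R (snd (Q i) - snd (P i), fst (P i) - fst (Q i)) \<in> inside C"
    and vert: "\<And>i. i \<in> J \<Longrightarrow> x \<noteq> fst (P i) \<and> x \<noteq> fst (Q i)"
    and cross: "\<And>i j t. i \<in> J \<Longrightarrow> j \<in> J \<Longrightarrow> i \<noteq> j \<Longrightarrow>
      (x, t) \<notin> closed_segment (P i) (Q i) \<inter> closed_segment (P j) (Q j)"
    and B: "\<And>w. w \<in> C \<union> inside C \<Longrightarrow> - B \<le> snd w"
  shows "measure lborel {t. (x, t) \<in> inside C} =
    (\<Sum>i\<in>J. sgn (fst (P i) - fst (Q i)) * (edge_height (P i) (Q i) x + B) *
       indicator (closed_segment (fst (P i)) (fst (Q i))) x)"
proof -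
  define E where "E = {i\<in>J. x \<in> closed_segment (fst (P i)) (fst (Q i))}"
  define y where "y i = edge_height (P i) (Q i) x" for i
  define s where "s i = sgn (fst (P i) - fst (Q i))" for i
  let ?U = "{t. (x, t) \<in> inside C}"
  have compact: "compact C" unfolding C using J by auto
  have mem: "(x, t) \<in> closed_segment (P i) (Q i) \<longleftrightarrow> i \<in> E \<and> t = y i" if "i \<in> J" for i t
    using vertical_line_meets_segment[of x "P i" "Q i" t] vert[OF that] that
    by (auto simp: E_def y_def)
  have EJ: "E \<subseteq> J" by (auto simp: E_def)
  have lim: "((\<lambda>t. (x, t)) \<longlongrightarrow> (x, z)) (at z)" for z :: real
    by (intro tendsto_intros)
  have "measure lborel ?U = (\<Sum>i\<in>E. s i * (y i + B))"
  proof (rule jump_measure)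
    show "finite E" using J by (simp add: E_def)
    show "inj_on y E"
    proof (rule inj_onI, rule ccontr)
      fix i j assume ij: "i \<in> E" "j \<in> E" "y i = y j" "i \<noteq> j"
      then have "(x, y i) \<in> closed_segment (P i) (Q i) \<inter> closed_segment (P j) (Q j)"
        using mem EJ by auto
      then show False using cross ij EJ by blast
    qed
    have "bounded (inside C)" using compact by (simp add: bounded_inside compact_imp_bounded)
    then have "bounded (snd ` inside C)" by (rule bounded_snd)
    then show "bounded ?U" by (rule bounded_subset) force
    have "open (inside C)" using compact by (simp add: open_inside compact_imp_closed)
    moreover have "?U = (\<lambda>t. (x, t)) -` inside C" by auto
    ultimately show "open ?U" by (auto intro!: open_vimage continuous_intros)
    show "?U \<subseteq> {-B..}" using B by force
    show "- B \<le> y i" if "i \<in> E" for i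
      using B[of "(x, y i)"] mem[of i "y i"] that EJ by (auto simp: C)
    show "\<forall>\<^sub>F t in at z. t \<in> ?U \<longleftrightarrow> z \<in> ?U" if "z \<notin> y ` E" for z
    proof -
      have "(x, z) \<in> - C" using that mem by (auto simp: C)
      then obtain \<delta> where \<delta>: "\<delta> > 0" "ball (x, z) \<delta> \<subseteq> - C"
        using compact by (meson compact_imp_closed open_Compl open_contains_ball)
      have D: "ball (x, z) \<delta> \<inter> C = {}" "(x, z) \<in> ball (x, z) \<delta>" using \<delta> by auto
      have "w \<in> inside C \<longleftrightarrow> (x, z) \<in> inside C" if w: "w \<in> ball (x, z) \<delta>" for w
        using connected_in_side(1)[OF connected_ball D(1) w]
          connected_in_side(1)[OF connected_ball D] w D(2) by blast
      then have "\<forall>\<^sub>F w in nhds (x, z). w \<in> inside C \<longleftrightarrow> (x, z) \<in> inside C"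
        by (rule eventually_mono[OF eventually_nhds_in_open[OF open_ball D(2)]])
      from eventually_compose_filterlim[OF this lim] show ?thesis by simp
    qed
    show "\<exists>k. \<forall>\<^sub>F t in at (y i). indicator ?U t - (if t < y i then s i else 0) = k"
      if i: "i \<in> E" for i
    proof -
      let ?n = "r i *\<^sub>R (snd (Q i) - snd (P i), fst (P i) - fst (Q i))"
      let ?z = "(x, y i)"
      \<comment> \<open>The rest of the polygon stays away from the crossing point.\<close>
      define K where "K = (\<Union>j\<in>J - {i}. closed_segment (P j) (Q j))"
      have iJ: "i \<in> J" using i EJ by auto
      have z: "?z \<in> closed_segment (P i) (Q i)" using i iJ mem by auto
      have z': "?z \<in> open_segment (P i) (Q i)"
        using z vert[OF iJ] by (auto simp: open_segment_def) (metis fst_conv)+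
      have perp: "(w - ?z) \<bullet> ?n = 0" if w: "w \<in> closed_segment (P i) (Q i)" for w
      proof -
        obtain u where u: "w = (1 - u) *\<^sub>R P i + u *\<^sub>R Q i"
          using w unfolding in_segment by blast
        obtain u' where u': "?z = (1 - u') *\<^sub>R P i + u' *\<^sub>R Q i"
          using z unfolding in_segment by blast
        have "w - ?z = (u - u') *\<^sub>R (Q i - P i)" unfolding u u' by (simp add: algebra_simps)
        show ?thesis unfolding \<open>w - ?z = _\<close> by (simp add: inner_prod_def algebra_simps)
      qed
      have "C = K \<union> closed_segment (P i) (Q i)" using iJ by (auto simp: C K_def)
      then have CK: "C \<subseteq> K \<union> {w. (w - ?z) \<bullet> ?n = 0}" using perp by auto
      have "closed K" unfolding K_def using J by auto
      moreover have "?z \<notin> K" using cross[OF iJ] z by (auto simp: K_def)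
      ultimately have "\<forall>\<^sub>F w in nhds ?z. ((w - ?z) \<bullet> ?n > 0 \<longrightarrow> w \<in> outside C) \<and>
          ((w - ?z) \<bullet> ?n < 0 \<longrightarrow> w \<in> inside C)"
        by (intro sides_near_edge_point[OF CK] orient[OF iJ z'])
      from eventually_compose_filterlim[OF this lim] have ev: "\<forall>\<^sub>F t in at (y i).
          ((t - y i) * (fst (P i) - fst (Q i)) > 0 \<longrightarrow> t \<notin> ?U) \<and>
          ((t - y i) * (fst (P i) - fst (Q i)) < 0 \<longrightarrow> t \<in> ?U)"
      proof eventually_elim
        case (elim t)
        have dot: "((x, t) - ?z) \<bullet> ?n = r i * ((t - y i) * (fst (P i) - fst (Q i)))"
          by (simp add: inner_prod_def)
        have sgn: "0 < r i * d \<longleftrightarrow> 0 < d" "r i * d < 0 \<longleftrightarrow> d < 0" for d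
          using r[OF iJ] by (simp_all add: zero_less_mult_iff mult_less_0_iff)
        show ?case using elim[unfolded dot sgn] inside_Int_outside[of C] by blast
      qed
      have ne: "\<forall>\<^sub>F t in at (y i). t \<noteq> y i" by (simp add: eventually_neq_at_within)
      have "fst (P i) \<noteq> fst (Q i)" using i vert[OF iJ] by (auto simp: E_def)
      then consider "fst (P i) > fst (Q i)" | "fst (P i) < fst (Q i)" by linarith
      then show ?thesis
      proof cases
        case 1
        have "\<forall>\<^sub>F t in at (y i). indicator ?U t - (if t < y i then s i else 0) = 0"
          using ev ne by eventually_elim
            (use 1 in \<open>auto simp: s_def indicator_def zero_less_mult_iff mult_less_0_iff\<close>)
        then show ?thesis by blast
      next
        case 2
        have "\<forall>\<^sub>F t in at (y i). indicator ?U t - (if t < y i then s i else 0) = 1"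
          using ev ne by eventually_elim
            (use 2 in \<open>auto simp: s_def indicator_def zero_less_mult_iff mult_less_0_iff\<close>)
        then show ?thesis by blast
      qed
    qed
  qed
  also have "\<dots> = (\<Sum>i\<in>J. s i * (y i + B) * indicator (closed_segment (fst (P i)) (fst (Q i))) x)"
    using J by (intro sum.mono_neutral_cong_left) (auto simp: E_def)
  finally show ?thesis unfolding s_def y_def .
qed

text \<open>
  The slices are measured for all abscissae but finitely many: those of vertices and of common
  points of two edges. The level \<open>- B\<close> enters the total with the factor \<open>\<Sum>i\<in>J. fst (Q i) - fst (P i)\<close>,
  which vanishes for a closed polygon.
\<close>

lemma polygon_region_area:
  fixes P Q :: "'i \<Rightarrow> real \<times> real" and r :: "'i \<Rightarrow> real"
  assumes J: "finite J"
    and C: "C = (\<Union>i\<in>J. closed_segment (P i) (Q i))"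
    and r: "\<And>i. i \<in> J \<Longrightarrow> r i > 0"
    and orient: "\<And>i x. i \<in> J \<Longrightarrow> x \<in> open_segment (P i) (Q i) \<Longrightarrow>
      \<forall>\<^sub>F \<epsilon> in at_right 0.
        x + \<epsilon> *\<^sub>R r i *\<^sub>R (snd (Q i) - snd (P i), fst (P i) - fst (Q i)) \<in> outside C \<and>
        x - \<epsilon> *\<^sub>R r i *\<^sub>R (snd (Q i) - snd (P i), fst (P i) - fst (Q i)) \<in> inside C"
    and simple: "\<And>i j. i \<in> J \<Longrightarrow> j \<in> J \<Longrightarrow> i \<noteq> j \<Longrightarrow>
      finite (closed_segment (P i) (Q i) \<inter> closed_segment (P j) (Q j))"
    and closed: "(\<Sum>i\<in>J. fst (Q i) - fst (P i)) = 0"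
  shows "measure lebesgue (inside C) =
    (\<Sum>i\<in>J. - (fst (Q i) - fst (P i)) * ((snd (P i) + snd (Q i)) / 2))"
proof -
  let ?I = "inside C"
  have compact: "compact C" unfolding C using J by auto
  have bI: "bounded ?I" using compact by (simp add: bounded_inside compact_imp_bounded)
  have oI: "open ?I" using compact by (simp add: open_inside compact_imp_closed)
  obtain B where B: "\<And>w. w \<in> C \<union> ?I \<Longrightarrow> - B \<le> snd w"
  proof -
    have "bounded (snd ` (C \<union> ?I))"
      using bI compact by (intro bounded_snd) (simp add: compact_imp_bounded)
    then obtain B where "\<And>w. w \<in> C \<union> ?I \<Longrightarrow> \<bar>snd w\<bar> \<le> B"
      unfolding bounded_iff by auto
    then show ?thesis using that[of B] by (metis abs_le_D2 minus_le_iff)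
  qed
  define bad where "bad = (\<Union>i\<in>J. {fst (P i), fst (Q i)}) \<union>
    (\<Union>i\<in>J. \<Union>j\<in>J - {i}. fst ` (closed_segment (P i) (Q i) \<inter> closed_segment (P j) (Q j)))"
  have "finite bad" unfolding bad_def using J simple by auto
  let ?f = "\<lambda>i x. sgn (fst (P i) - fst (Q i)) * (edge_height (P i) (Q i) x + B) *
       indicator (closed_segment (fst (P i)) (fst (Q i))) x"
  have slice: "measure lborel {t. (x, t) \<in> ?I} = (\<Sum>i\<in>J. ?f i x)" if "x \<notin> bad" for x
  proof (rule slice_measure[OF J C r orient])
    show "x \<noteq> fst (P i) \<and> x \<noteq> fst (Q i)" if "i \<in> J" for i
      using \<open>x \<notin> bad\<close> that by (auto simp: bad_def)
    show "(x, t) \<notin> closed_segment (P i) (Q i) \<inter> closed_segment (P j) (Q j)"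
      if "i \<in> J" "j \<in> J" "i \<noteq> j" for i j t
      using \<open>x \<notin> bad\<close> that unfolding bad_def by force
  qed (use B in auto)
  have int: "integrable (lborel \<Otimes>\<^sub>M lborel) (indicator ?I :: _ \<Rightarrow> real)"
    using oI emeasure_bounded_finite[OF bI] unfolding lborel_prod
    by (intro integrable_real_indicator) (auto simp: less_top)
  have slice_eq: "(\<integral>t. indicator ?I (x, t) \<partial>lborel) = measure lborel {t. (x, t) \<in> ?I}" for x
  proof -
    have "(\<lambda>t. indicator ?I (x, t)) = (indicator {t. (x, t) \<in> ?I} :: real \<Rightarrow> real)"
      by (auto simp: indicator_def)
    then show ?thesis by simp
  qed
  have "measure lebesgue ?I = measure lborel ?I" using oI by (simp add: measure_completion)
  also have "\<dots> = (\<integral>z. indicator ?I z \<partial>lborel)" by simp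
  also have "\<dots> = (\<integral>z. indicator ?I z \<partial>(lborel \<Otimes>\<^sub>M lborel))" by (simp add: lborel_prod)
  also have "\<dots> = (\<integral>x. (\<integral>t. indicator ?I (x, t) \<partial>lborel) \<partial>lborel)"
    by (rule lborel_pair.integral_fst'[OF int, symmetric])
  also have "\<dots> = (\<integral>x. measure lborel {t. (x, t) \<in> ?I} \<partial>lborel)"
    by (simp only: slice_eq)
  also have "\<dots> = (\<integral>x. (\<Sum>i\<in>J. ?f i x) \<partial>lborel)"
  proof (rule integral_cong_AE)
    show "(\<lambda>x. measure lborel {t. (x, t) \<in> ?I}) \<in> borel_measurable lborel"
      using borel_measurable_integrable[OF lborel_pair.integrable_fst'[OF int]]
      by (simp only: slice_eq)
    show "(\<lambda>x. \<Sum>i\<in>J. ?f i x) \<in> borel_measurable lborel"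
      by (rule borel_measurable_integrable, rule Bochner_Integration.integrable_sum,
          rule integrable.intros, rule has_integral_edge_height)
    show "AE x in lborel. measure lborel {t. (x, t) \<in> ?I} = (\<Sum>i\<in>J. ?f i x)"
      by (rule eventually_mono[OF AE_not_in[OF finite_imp_null_set_lborel[OF \<open>finite bad\<close>]] slice])
  qed
  also have "\<dots> = (\<Sum>i\<in>J. - (fst (Q i) - fst (P i)) * ((snd (P i) + snd (Q i)) / 2 + B))"
    by (intro has_bochner_integral_integral_eq has_bochner_integral_sum has_integral_edge_height)
  also have "\<dots> = (\<Sum>i\<in>J. - (fst (Q i) - fst (P i)) * ((snd (P i) + snd (Q i)) / 2))
      - (\<Sum>i\<in>J. fst (Q i) - fst (P i)) * B"
    unfolding sum_distrib_right sum_subtractf[symmetric]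
    by (intro sum.cong refl) (simp add: algebra_simps)
  finally show ?thesis using closed by simp
qed

section \<open>Edges of the boundary polygon and the substrate area\<close>

lemma polyline_ends:
  assumes "ws \<noteq> []"
  shows "pathstart (polyline ws) = hd ws" "pathfinish (polyline ws) = last ws"
  using assms by (induction ws rule: polyline.induct) auto

lemma path_image_polyline:
  assumes "2 \<le> length ws"
  shows "path_image (polyline ws) = (\<Union>(p, q)\<in>set (zip ws (tl ws)). closed_segment p q)"
  using assms
proof (induction ws rule: polyline.induct)
  case (4 a b c xs)
  then show ?case using polyline_ends[of "b # c # xs"] by (simp add: path_image_join)
qed auto

text \<open>
  Injectivity of the path enters the area formula only in this form: two different edges, that is,
  edges at different positions of the list, have finitely many common points.
\<close>

lemma edges_of_arc:
  assumes "2 \<le> length ws" "arc (polyline ws)"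
  shows "sorted_wrt (\<lambda>(p, q) (p', q'). finite (closed_segment p q \<inter> closed_segment p' q'))
    (zip ws (tl ws))"
  using assms
proof (induction ws rule: polyline.induct)
  case (4 a b c xs)
  let ?ws = "b # c # xs"
  have j: "pathfinish (linepath a b) = pathstart (polyline ?ws)"
    using polyline_ends[of ?ws] by simp
  have *: "arc (polyline ?ws)" "closed_segment a b \<inter> path_image (polyline ?ws) \<subseteq> {b}"
    using 4(3) arc_join_eq[OF j] polyline_ends[of ?ws] by auto
  have "finite (closed_segment a b \<inter> closed_segment p q)"
    if "(p, q) \<in> set (zip ?ws (tl ?ws))" for p q
    by (rule finite_subset[of _ "{b}"]) (use *(2) path_image_polyline[of ?ws] that in fastforce)+
  moreover have "sorted_wrt (\<lambda>(p, q) (p', q'). finite (closed_segment p q \<inter> closed_segment p' q'))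
    (zip ?ws (tl ?ws))" using 4(1) * by simp
  ultimately show ?case by fastforce
qed auto

lemma bedges_conv_closed_walk:
  assumes "bverts M \<noteq> []"
  shows "bedges M = zip (bverts M @ [hd (bverts M)]) (tl (bverts M @ [hd (bverts M)]))"
proof -
  obtain a xs where vs: "bverts M = a # xs" using assms by (cases "bverts M") auto
  have "zip ((a # xs) @ [a]) (xs @ [a]) = zip (a # xs) (xs @ [a])"
    by (subst zip_append1) simp
  then show ?thesis unfolding bedges_def vs by simp
qed

text \<open>
  The first edge of the loop meets the remaining arc in both of its end points, so the loop
  is split once and the rest is covered by the statement for arcs.
\<close>

lemma edges_of_simple_loop:
  assumes len: "3 \<le> length (bverts M)"
    and simple: "simple_path (polyline (bverts M @ [hd (bverts M)]))"
  shows "sorted_wrt (\<lambda>(p, q) (p', q'). finite (closed_segment p q \<inter> closed_segment p' q'))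
    (bedges M)"
proof -
  obtain a b c xs where vs: "bverts M = a # b # c # xs"
    using len by (metis Suc_le_length_iff numeral_3_eq_3)
  let ?ws = "b # c # xs @ [a]"
  have j: "pathfinish (linepath a b) = pathstart (polyline ?ws)"
    "pathfinish (polyline ?ws) = pathstart (linepath a b)"
    using polyline_ends[of ?ws] by simp_all
  have "simple_path (linepath a b +++ polyline ?ws)" using simple vs by simp
  then have *: "arc (polyline ?ws)" "closed_segment a b \<inter> path_image (polyline ?ws) \<subseteq> {a, b}"
    using simple_path_join_loop_eq[OF j(2,1)] polyline_ends[of ?ws] by auto
  have "finite (closed_segment a b \<inter> closed_segment p q)"
    if "(p, q) \<in> set (zip ?ws (tl ?ws))" for p q
    by (rule finite_subset[of _ "{a, b}"]) (use *(2) path_image_polyline[of ?ws] that in fastforce)+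
  moreover have "sorted_wrt (\<lambda>(p, q) (p', q'). finite (closed_segment p q \<inter> closed_segment p' q'))
    (zip ?ws (tl ?ws))" using edges_of_arc[of ?ws] * by simp
  moreover have "bedges M = (a, b) # zip ?ws (tl ?ws)"
    using vs by (subst bedges_conv_closed_walk) auto
  ultimately show ?thesis by fastforce
qed

lemma polyhedral_bedges:
  assumes "polyhedral_surface M" "(p, q) \<in> set (bedges M)"
  shows "\<exists>\<sigma>\<in>tris M. closed_segment p q \<subseteq> \<sigma>" "p \<noteq> q" "p $ 3 = 0" "q $ 3 = 0"
proof -
  have "{e. \<exists>!\<sigma>. \<sigma> \<in> tris M \<and> e edge_of \<sigma>} = (\<lambda>(p, q). closed_segment p q) ` set (bedges M)"
    using assms(1) unfolding polyhedral_surface_def by (elim conjE)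
  moreover have "closed_segment p q \<in> (\<lambda>(p, q). closed_segment p q) ` set (bedges M)"
    by (rule image_eqI[OF _ assms(2)]) simp
  ultimately have "closed_segment p q \<in> {e. \<exists>!\<sigma>. \<sigma> \<in> tris M \<and> e edge_of \<sigma>}" by simp
  then obtain \<sigma> where \<sigma>: "\<sigma> \<in> tris M" "closed_segment p q edge_of \<sigma>" by blast
  then show "\<exists>\<sigma>\<in>tris M. closed_segment p q \<subseteq> \<sigma>" using edge_of_imp_subset by blast
  show "p \<noteq> q" using \<sigma>(2) by (auto simp: edge_of_def)
  have "p \<in> set (bverts M)" "q \<in> set (bverts M)"
    using assms(2) unfolding bedges_def by (auto dest: set_zip_leftD set_zip_rightD)
  then show "p $ 3 = 0" "q $ 3 = 0" using assms(1) by (auto simp: polyhedral_surface_def)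
qed

lemma linear_plane_pr: "linear plane_pr"
  by (auto intro!: linearI simp: plane_pr_def)

lemma plane_pr_bd_normal:
  "plane_pr (x + \<epsilon> *\<^sub>R bd_normal p q) = plane_pr x +
     \<epsilon> *\<^sub>R (1 / dist p q) *\<^sub>R (q $ 2 - p $ 2, p $ 1 - q $ 1)"
  by (simp add: plane_pr_def bd_normal_def cross3_simps axis_def divide_simps)

lemma sum_list_bedges_telescope:
  fixes f :: "real^3 \<Rightarrow> real"
  shows "(\<Sum>(p, q)\<leftarrow>bedges M. f q - f p) = 0"
proof -
  have "(\<Sum>(p, q)\<leftarrow>zip xs ys. f q - f p) = sum_list (map f ys) - sum_list (map f xs)"
    if "length xs = length ys" for xs ys
    using that by (induction rule: list_induct2) auto
  moreover have "sum_list (map f (rotate1 xs)) = sum_list (map f xs)" for xs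
    by (cases xs) auto
  ultimately show ?thesis unfolding bedges_def by simp
qed

text \<open>
  The summand of the shoelace formula for the edge from \<open>p\<close> to \<open>q\<close>: minus the signed area below
  the edge.
\<close>

definition edge_area :: "real^3 \<Rightarrow> real^3 \<Rightarrow> real" where
  "edge_area p q = - (q $ 1 - p $ 1) * ((p $ 2 + q $ 2) / 2)"

lemma substrate_area:
  assumes M: "polyhedral_surface M"
  shows "measure lebesgue (substrate_region M) = (\<Sum>(p, q)\<leftarrow>bedges M. edge_area p q)"
proof -
  define es where "es = bedges M"
  define a where "a i = fst (es ! i)" for i
  define b where "b i = snd (es ! i)" for i
  define J where "J = {..<length es}"
  let ?C = "plane_pr ` bd_surf M"
  have e: "(a i, b i) \<in> set (bedges M)" if "i \<in> J" for i
    using that nth_mem[of i es] by (simp add: a_def b_def es_def J_def)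
  note edge = polyhedral_bedges[OF M e]
  have seg: "closed_segment (plane_pr p) (plane_pr q) = plane_pr ` closed_segment p q" for p q
    by (rule closed_segment_linear_image[OF linear_plane_pr])
  have plane: "closed_segment (a i) (b i) \<subseteq> {x. x $ 3 = 0}" if "i \<in> J" for i
    using edge(3,4)[OF that] by (auto simp: in_segment)
  \<comment> \<open>The boundary lies in the substrate plane, so its projection creates no new intersections.\<close>
  have inj: "inj_on plane_pr {x. x $ 3 = 0}"
    by (auto simp: inj_on_def plane_pr_def vec_eq_iff forall_3)
  have sum: "(\<Sum>(p, q)\<leftarrow>bedges M. f p q) = (\<Sum>i\<in>J. f (a i) (b i))" for f :: "_ \<Rightarrow> _ \<Rightarrow> real"
    unfolding sum_list_sum_nth es_def[symmetric] J_def
    by (auto simp: a_def b_def atLeast0LessThan split_beta intro!: sum.cong)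
  have "measure lebesgue (inside ?C) =
    (\<Sum>i\<in>J. - (fst (plane_pr (b i)) - fst (plane_pr (a i))) *
       ((snd (plane_pr (a i)) + snd (plane_pr (b i))) / 2))"
  proof (rule polygon_region_area[where r = "\<lambda>i. 1 / dist (a i) (b i)"])
    show "finite J" by (simp add: J_def)
    have "set (bedges M) = (\<lambda>i. (a i, b i)) ` J"
      unfolding J_def a_def b_def es_def by (auto simp: set_conv_nth image_iff)
    then show "?C = (\<Union>i\<in>J. closed_segment (plane_pr (a i)) (plane_pr (b i)))"
      unfolding bd_surf_def seg by auto
    show "0 < 1 / dist (a i) (b i)" if "i \<in> J" for i using edge(2)[OF that] by simp
    show "\<forall>\<^sub>F \<epsilon> in at_right 0.
        y + \<epsilon> *\<^sub>R (1 / dist (a i) (b i)) *\<^sub>R (snd (plane_pr (b i)) - snd (plane_pr (a i)),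
          fst (plane_pr (a i)) - fst (plane_pr (b i))) \<in> outside ?C \<and>
        y - \<epsilon> *\<^sub>R (1 / dist (a i) (b i)) *\<^sub>R (snd (plane_pr (b i)) - snd (plane_pr (a i)),
          fst (plane_pr (a i)) - fst (plane_pr (b i))) \<in> inside ?C"
      if i: "i \<in> J" and y: "y \<in> open_segment (plane_pr (a i)) (plane_pr (b i))" for i y
    proof -
      obtain u where u: "0 < u" "u < 1" "y = (1 - u) *\<^sub>R plane_pr (a i) + u *\<^sub>R plane_pr (b i)"
        using y by (auto simp: in_segment)
      define x where "x = (1 - u) *\<^sub>R a i + u *\<^sub>R b i"
      have x: "x \<in> open_segment (a i) (b i)" using u edge(2)[OF i] by (auto simp: in_segment x_def)
      have y: "y = plane_pr x" using u(3) by (simp add: x_def plane_pr_def)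
      have ev: "\<forall>\<^sub>F \<epsilon> in at_right 0.
          plane_pr (x + \<epsilon> *\<^sub>R bd_normal (a i) (b i)) \<in> outside ?C \<and>
          plane_pr (x - \<epsilon> *\<^sub>R bd_normal (a i) (b i)) \<in> inside ?C"
        using M e[OF i] x
        unfolding polyhedral_surface_def positively_oriented_bd_def substrate_region_def by fast
      have minus: "plane_pr (x - \<epsilon> *\<^sub>R bd_normal p q) = plane_pr x -
          \<epsilon> *\<^sub>R (1 / dist p q) *\<^sub>R (q $ 2 - p $ 2, p $ 1 - q $ 1)" for \<epsilon> p q
        using plane_pr_bd_normal[of x "- \<epsilon>" p q] by simp
      have comp: "(snd (plane_pr q) - snd (plane_pr p), fst (plane_pr p) - fst (plane_pr q)) =
          (q $ 2 - p $ 2, p $ 1 - q $ 1)" for p q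
        by (simp add: plane_pr_def)
      from ev show ?thesis unfolding y comp plane_pr_bd_normal minus .
    qed
    show "finite (closed_segment (plane_pr (a i)) (plane_pr (b i)) \<inter>
        closed_segment (plane_pr (a j)) (plane_pr (b j)))" if "i \<in> J" "j \<in> J" "i \<noteq> j" for i j
    proof -
      have lt: "finite (closed_segment (a i) (b i) \<inter> closed_segment (a j) (b j))"
        if "i < j" "j < length es" for i j
        using sorted_wrt_nth_less[OF edges_of_simple_loop that[unfolded es_def]] M
        by (simp add: polyhedral_surface_def a_def b_def es_def split_beta)
      have "finite (closed_segment (a i) (b i) \<inter> closed_segment (a j) (b j))"
        using lt[of i j] lt[of j i] that by (cases "i < j") (auto simp: J_def Int_commute)
      then have "finite (plane_pr ` (closed_segment (a i) (b i) \<inter> closed_segment (a j) (b j)))"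
        by simp
      then show ?thesis
        unfolding seg using inj_on_image_Int[OF inj plane plane] that by metis
    qed
    show "(\<Sum>i\<in>J. fst (plane_pr (b i)) - fst (plane_pr (a i))) = 0"
      using sum_list_bedges_telescope[of "\<lambda>x. x $ 1" M] unfolding sum by (simp add: plane_pr_def)
  qed
  then show ?thesis unfolding substrate_region_def sum by (simp add: edge_area_def plane_pr_def)
qed

section \<open>Area and integral on a triangle\<close>

lemma simplex_2_hull:
  fixes a b c :: "real^3"
  assumes "2 simplex (convex hull {a, b, c})"
  shows "\<not> affine_dependent {a, b, c}" "a \<noteq> b" "a \<noteq> c" "b \<noteq> c"
proof -
  have d: "aff_dim {a, b, c} = 2" using aff_dim_simplex[OF assms] by (simp add: aff_dim_convex_hull)
  have "aff_dim {a, b, c} \<le> int (card {a, b, c}) - 1" using aff_dim_le_card[of "{a, b, c}"] by simp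
  moreover have "card {a, b, c} \<le> 3" by (simp add: card_insert_if)
  ultimately have card: "card {a, b, c} = 3" using d by linarith
  then show "a \<noteq> b" "a \<noteq> c" "b \<noteq> c" by (auto simp: card_insert_if split: if_splits)
  show "\<not> affine_dependent {a, b, c}"
    using d card by (simp add: affine_independent_iff_card)
qed

lemma cross3_edges_nonzero:
  assumes "2 simplex (convex hull {a, b, c})"
  shows "cross3 (b - a) (c - a) \<noteq> 0"
proof
  assume "cross3 (b - a) (c - a) = 0"
  then have "collinear {0, b - a, c - a}" by (simp add: cross_eq_0)
  then have "collinear {b, a, c}" by (subst collinear_3) simp_all
  then have "collinear {a, b, c}" by (simp add: insert_commute)
  then show False
    using simplex_2_hull[OF assms] by (simp add: collinear_3_eq_affine_dependent)
qed

lemma corners_hull: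
  assumes "2 simplex \<sigma>" "corners \<sigma> = (a, b, c)"
  shows "\<sigma> = convex hull {a, b, c}"
proof -
  obtain S where S: "int (card S) = 2 + 1" "\<sigma> = convex hull S"
    using assms(1) unfolding simplex_def by blast
  then have "card S = 3" by simp
  then obtain p q r where "S = {p, q, r}" by (auto simp: card_3_iff)
  then have "case (p, q, r) of (a, b, c) \<Rightarrow> \<sigma> = convex hull {a, b, c}" using S by simp
  then have "case corners \<sigma> of (a, b, c) \<Rightarrow> \<sigma> = convex hull {a, b, c}"
    unfolding corners_def by (rule someI)
  then show ?thesis using assms(2) by simp
qed

lemma cross3_edges_perm:
  "norm (cross3 (a - b) (c - b)) = norm (cross3 (b - a) (c - a))"
  "norm (cross3 (c - a) (b - a)) = norm (cross3 (b - a) (c - a))"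
proof -
  have "cross3 (a - b) (c - b) = - cross3 (b - a) (c - a)"
    by (simp add: cross3_simps)
  then show "norm (cross3 (a - b) (c - b)) = norm (cross3 (b - a) (c - a))"
    by (metis norm_minus_cancel)
  show "norm (cross3 (c - a) (b - a)) = norm (cross3 (b - a) (c - a))"
    by (metis cross_skew norm_minus_cancel)
qed

text \<open>
  The corners of a triangle are its extreme points, so any two choices of them differ by a
  permutation, and these change the cross product of the edge vectors only in sign.
\<close>

lemma tri_area_hull:
  assumes "2 simplex (convex hull {a, b, c})"
  shows "tri_area (convex hull {a, b, c}) = norm (cross3 (b - a) (c - a)) / 2"
proof -
  obtain p q r where pqr: "corners (convex hull {a, b, c}) = (p, q, r)" by (metis prod_cases3)
  have hull: "convex hull {a, b, c} = convex hull {p, q, r}" by (rule corners_hull[OF assms pqr])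
  have s: "2 simplex (convex hull {p, q, r})" using assms hull by simp
  have "x \<in> {a, b, c} \<longleftrightarrow> x \<in> {p, q, r}" for x
    using extreme_point_of_convex_hull_affine_independent[OF simplex_2_hull(1)[OF assms]]
      extreme_point_of_convex_hull_affine_independent[OF simplex_2_hull(1)[OF s]] hull by metis
  then have eq: "{a, b, c} = {p, q, r}" by blast
  have ne: "a \<noteq> b" "a \<noteq> c" "b \<noteq> c"
    by (rule simplex_2_hull[OF assms])+
  define N where "N x y z = norm (cross3 (y - x) (z - x))" for x y z :: "real^3"
  have N: "N y x z = N x y z" "N x z y = N x y z" for x y z
    unfolding N_def by (rule cross3_edges_perm)+
  have "p \<in> {a, b, c}" "q \<in> {a, b, c}" "r \<in> {a, b, c}"
    "a \<in> {p, q, r}" "b \<in> {p, q, r}" "c \<in> {p, q, r}" using eq by auto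
  then have "(p, q, r) \<in> {(a, b, c), (a, c, b), (b, a, c), (b, c, a), (c, a, b), (c, b, a)}"
    using ne by auto
  then have "N p q r = N a b c" using N by auto
  then show ?thesis unfolding tri_area_def pqr by (simp add: N_def)
qed

lemma reference_triangle_integral:
  "integral {(s, t). 0 \<le> s \<and> 0 \<le> t \<and> s + t \<le> (1::real)} (\<lambda>_. k) = k / (2::real)"
proof -
  let ?T = "{(s, t). 0 \<le> s \<and> 0 \<le> t \<and> s + t \<le> (1::real)}"
  have T: "?T = convex hull (insert 0 Basis)"
    unfolding std_simplex by (auto simp: Basis_prod_def sum.union_disjoint inner_prod_def)
  have "compact ?T" unfolding T by (intro finite_imp_compact_convex_hull) simp
  then have "?T \<in> lmeasurable" by (rule lmeasurable_compact)
  have "measure lebesgue ?T = measure lborel ?T"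
    using \<open>compact ?T\<close> by (intro measure_completion) (simp add: borel_compact)
  also have "\<dots> = 1 / 2" unfolding T by (subst content_std_simplex) (simp add: fact_numeral)
  finally have "integral ?T (\<lambda>_. 1::real) = 1 / 2"
    using lmeasure_integral[OF \<open>?T \<in> lmeasurable\<close>] by simp
  then have "integral ?T (\<lambda>_. k * 1) = k * (1 / 2)" by (subst integral_mult_right) simp
  then show ?thesis by simp
qed

lemma tri_integral_const:
  assumes "2 simplex \<sigma>" and k: "\<And>x. x \<in> \<sigma> \<Longrightarrow> f x = k"
  shows "tri_integral \<sigma> f = tri_area \<sigma> * k"
proof -
  obtain a b c where abc: "corners \<sigma> = (a, b, c)" by (metis prod_cases3)
  have hull: "\<sigma> = convex hull {a, b, c}" by (rule corners_hull[OF assms(1) abc])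
  let ?T = "{(s, t). 0 \<le> s \<and> 0 \<le> t \<and> s + t \<le> (1::real)}"
  have "integral ?T (\<lambda>(s, t). f (a + s *\<^sub>R (b - a) + t *\<^sub>R (c - a))) = integral ?T (\<lambda>_. k)"
  proof (rule integral_cong)
    fix z assume z: "z \<in> ?T"
    obtain s t where st: "z = (s, t)" by force
    have "a + s *\<^sub>R (b - a) + t *\<^sub>R (c - a) \<in> \<sigma>"
      unfolding hull convex_hull_3 using z st
      by (intro CollectI exI[of _ "1 - s - t"] exI[of _ s] exI[of _ t]) (auto simp: algebra_simps)
    then show "(case z of (s, t) \<Rightarrow> f (a + s *\<^sub>R (b - a) + t *\<^sub>R (c - a))) = k"
      using k st by simp
  qed
  then show ?thesis
    unfolding tri_integral_def tri_area_def abc by (simp add: reference_triangle_integral)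
qed

lemma tri_area_nonneg: "0 \<le> tri_area \<sigma>"
  by (simp add: tri_area_def split: prod.split)

text \<open>
  The integral of a function that is not integrable is \<open>0\<close>, which has the right sign too.
\<close>

lemma tri_integral_nonneg:
  assumes "\<And>x. 0 \<le> f x"
  shows "0 \<le> tri_integral \<sigma> f"
proof -
  have "0 \<le> integral T g" if "\<And>z. 0 \<le> g z" for T and g :: "real \<times> real \<Rightarrow> real"
    using that integral_nonneg[of g T] not_integrable_integral[of g T] by fastforce
  then show ?thesis using assms by (auto simp: tri_integral_def split: prod.split)
qed

section \<open>Tangential gradients and the growth of area\<close>

lemma orthonormal_frame:
  fixes u w :: "real^3"
  assumes "cross3 u w \<noteq> 0"
  obtains e f \<alpha> \<beta> \<gamma> where "norm e = 1" "norm f = 1" "e \<bullet> f = 0"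
    "u = \<gamma> *\<^sub>R e" "w = \<alpha> *\<^sub>R e + \<beta> *\<^sub>R f" "\<gamma> \<noteq> 0" "\<beta> \<noteq> 0"
proof -
  have u: "u \<noteq> 0" using assms by auto
  define e where "e = u /\<^sub>R norm u"
  define r where "r = w - (w \<bullet> e) *\<^sub>R e"
  have e: "norm e = 1" "u = norm u *\<^sub>R e" using u by (simp_all add: e_def)
  have r: "r \<noteq> 0"
  proof
    assume "r = 0"
    then have w: "w = (w \<bullet> e) *\<^sub>R e" by (simp add: r_def)
    have "cross3 (norm u *\<^sub>R e) ((w \<bullet> e) *\<^sub>R e) = 0" by (simp add: cross_mult_left cross_mult_right)
    then show False using assms w e(2) by metis
  qed
  have "e \<bullet> r = 0" using e(1) by (simp add: r_def inner_diff_right inner_commute norm_eq_1)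
  show thesis
  proof (rule that[of e "r /\<^sub>R norm r" "norm u" "w \<bullet> e" "norm r"])
    show "w = (w \<bullet> e) *\<^sub>R e + norm r *\<^sub>R (r /\<^sub>R norm r)" using r by (simp add: r_def)
  qed (use e r u \<open>e \<bullet> r = 0\<close> in auto)
qed

lemma tangent_space_of_triangle:
  fixes a b c :: "real^3"
  assumes x: "x \<in> convex hull {a, b, c}"
    and ef: "b - a = \<gamma> *\<^sub>R e" "c - a = \<alpha> *\<^sub>R e + \<beta> *\<^sub>R f" "\<gamma> \<noteq> 0" "\<beta> \<noteq> 0"
  shows "span ((\<lambda>y. y - x) ` (convex hull {a, b, c})) = span {e, f}"
proof (rule span_eq[THEN iffD2], intro conjI)
  let ?S = "convex hull {a, b, c}"
  have from_a: "y - a \<in> span {e, f}" if "y \<in> ?S" for y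
  proof -
    obtain r s t where "y = r *\<^sub>R a + s *\<^sub>R b + t *\<^sub>R c" "r + s + t = 1"
      using \<open>y \<in> ?S\<close> unfolding convex_hull_3 by auto
    then have y: "y = r *\<^sub>R a + s *\<^sub>R b + t *\<^sub>R c" and r: "r = 1 - s - t" by simp_all
    have "y - a = s *\<^sub>R (b - a) + t *\<^sub>R (c - a)" unfolding y r by (simp add: algebra_simps)
    then show ?thesis unfolding ef(1,2)
      by (simp add: span_add span_scale span_base)
  qed
  show "(\<lambda>y. y - x) ` ?S \<subseteq> span {e, f}"
  proof
    fix z assume "z \<in> (\<lambda>y. y - x) ` ?S"
    then obtain y where "y \<in> ?S" "z = (y - a) - (x - a)" by auto
    then show "z \<in> span {e, f}" using from_a x by (simp only: span_diff)
  qed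
  let ?T = "span ((\<lambda>y. y - x) ` ?S)"
  have in_T: "y - x \<in> ?T" if "y \<in> ?S" for y using that by (intro span_base) blast
  have corner: "a \<in> ?S" "b \<in> ?S" "c \<in> ?S" by (auto intro: hull_inc)
  have ba: "b - a \<in> ?T" using span_diff[OF in_T[OF corner(2)] in_T[OF corner(1)]] by simp
  have ca: "c - a \<in> ?T" using span_diff[OF in_T[OF corner(3)] in_T[OF corner(1)]] by simp
  have "e = (1 / \<gamma>) *\<^sub>R (b - a)" using ef by simp
  then have e: "e \<in> ?T" using span_scale[OF ba] by simp
  have "f = (1 / \<beta>) *\<^sub>R ((c - a) - \<alpha> *\<^sub>R e)" using ef by simp
  then have "f \<in> ?T" using span_scale[OF span_diff[OF ca span_scale[OF e]]] by simp
  then show "{e, f} \<subseteq> ?T" using e by blast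
qed

text \<open>
  A derivative within a lower-dimensional set is not unique, but its values on the
  directions into a convex set are, being derivatives along segments. So the representing vector is
  unique in the span of these directions.
\<close>

lemma gradient_within_convex_unique:
  fixes x :: "'a::euclidean_space" and f :: "'a \<Rightarrow> real"
  assumes S: "convex S" "x \<in> S"
    and g: "g \<in> span ((\<lambda>y. y - x) ` S)" "(f has_derivative (\<lambda>h. g \<bullet> h)) (at x within S)"
    and g': "g' \<in> span ((\<lambda>y. y - x) ` S)" "(f has_derivative (\<lambda>h. g' \<bullet> h)) (at x within S)"
  shows "g = g'"
proof -
  have "orthogonal (g - g') z" if z: "z \<in> (\<lambda>y. y - x) ` S" for z
  proof -
    obtain y where y: "y \<in> S" "z = y - x" using z by blast
    define \<phi> where "\<phi> t = x + t *\<^sub>R (y - x)" for t :: real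
    have "\<phi> t \<in> S" if "t \<in> {0..1}" for t
      using convexD_alt[OF S(1,2) y(1), of t] that by (simp add: \<phi>_def algebra_simps)
    then have sub: "\<phi> ` {0..1} \<subseteq> S" by blast
    have d\<phi>: "(\<phi> has_derivative (\<lambda>h. h *\<^sub>R (y - x))) (at 0 within {0..1})"
      unfolding \<phi>_def by (auto intro!: derivative_eq_intros)
    have "((f \<circ> \<phi>) has_vector_derivative k \<bullet> (y - x)) (at 0 within {0..1})"
      if "(f has_derivative (\<lambda>h. k \<bullet> h)) (at x within S)" for k
    proof -
      have "(f has_derivative (\<lambda>h. k \<bullet> h)) (at (\<phi> 0) within \<phi> ` {0..1})"
        using has_derivative_subset[OF that sub] by (simp add: \<phi>_def)
      from diff_chain_within[OF d\<phi> this] show ?thesis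
        by (simp add: has_vector_derivative_def o_def)
    qed
    from this[OF g(2)] this[OF g'(2)] have "g \<bullet> (y - x) = g' \<bullet> (y - x)"
      by (rule vector_derivative_unique_within[rotated]) (simp add: at_within_Icc_at_right)
    then show ?thesis by (simp add: orthogonal_def inner_diff_left y(2))
  qed
  then have "orthogonal (g - g') (g - g')"
    using orthogonal_to_span[OF span_diff[OF g(1) g'(1)]] by blast
  then show ?thesis by (simp add: orthogonal_def)
qed

text \<open>
  In an orthonormal frame of the plane of the triangle, the vector that represents the restriction of
  a linear functional to this plane is read off from its values on the frame.
\<close>

lemma tgrad_affine:
  fixes a b c :: "real^3"
  assumes x: "x \<in> convex hull {a, b, c}"
    and ef: "b - a = \<gamma> *\<^sub>R e" "c - a = \<alpha> *\<^sub>R e + \<beta> *\<^sub>R f" "\<gamma> \<noteq> 0" "\<beta> \<noteq> 0"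
    and orth: "norm e = 1" "norm f = 1" "e \<bullet> f = 0"
    and A: "linear A" "\<And>y. y \<in> convex hull {a, b, c} \<Longrightarrow> g y = A y + d"
  shows "tgrad (convex hull {a, b, c}) g x = A e *\<^sub>R e + A f *\<^sub>R f"
proof -
  let ?S = "convex hull {a, b, c}" and ?G = "A e *\<^sub>R e + A f *\<^sub>R f"
  note T = tangent_space_of_triangle[OF x ef]
  have G: "?G \<bullet> z = A z" if z_span: "z \<in> span {e, f}" for z
  proof -
    obtain s t where z: "z = s *\<^sub>R e + t *\<^sub>R f"
    proof -
      obtain s t where "z - s *\<^sub>R e - t *\<^sub>R f = 0"
        using z_span by (auto simp: span_breakdown_eq)
      then have "z = s *\<^sub>R e + t *\<^sub>R f" by (simp add: algebra_simps)
      then show ?thesis using that by blast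
    qed
    have 1: "e \<bullet> e = 1" "f \<bullet> f = 1" "f \<bullet> e = 0"
      using orth by (simp_all add: norm_eq_1 inner_commute)
    show ?thesis unfolding z
      by (simp add: linear_add[OF A(1)] linear_scale[OF A(1)] inner_simps 1 orth(3))
  qed
  have inT: "?G \<in> span ((\<lambda>y. y - x) ` ?S)" unfolding T
    by (intro span_add span_scale span_base) auto
  have "g y = g x + ?G \<bullet> (y - x)" if "y \<in> ?S" for y
  proof -
    have "y - x \<in> span {e, f}" unfolding T[symmetric] using that by (intro span_base) blast
    then show ?thesis using G A(2)[OF that] A(2)[OF x] by (simp add: linear_diff[OF A(1)])
  qed
  moreover have "((\<lambda>y. g x + ?G \<bullet> (y - x)) has_derivative (\<lambda>h. ?G \<bullet> h)) (at x within ?S)"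
    by (auto intro!: derivative_eq_intros)
  ultimately have der: "(g has_derivative (\<lambda>h. ?G \<bullet> h)) (at x within ?S)"
    using has_derivative_transform[OF x, of g "\<lambda>y. g x + ?G \<bullet> (y - x)"] by blast
  show ?thesis unfolding tgrad_def
  proof (rule the_equality)
    show "?G \<in> span ((\<lambda>y. y - x) ` ?S) \<and> (g has_derivative (\<lambda>h. ?G \<bullet> h)) (at x within ?S)"
      using inT der by blast
    show "k = ?G"
      if "k \<in> span ((\<lambda>y. y - x) ` ?S) \<and> (g has_derivative (\<lambda>h. k \<bullet> h)) (at x within ?S)" for k
      using gradient_within_convex_unique[OF convex_convex_hull x _ _ inT der] that by blast
  qed
qed

lemma norm_cross3_le: "norm (cross3 x y) \<le> ((norm x)\<^sup>2 + (norm y)\<^sup>2) / 2"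
proof -
  have "(norm (cross3 x y))\<^sup>2 \<le> (norm x * norm y)\<^sup>2"
    using norm_cross_dot[of x y] zero_le_power2[of "x \<bullet> y"] by linarith
  then have "norm (cross3 x y) \<le> norm x * norm y" by (rule power2_le_imp_le) simp
  also have "\<dots> \<le> ((norm x)\<^sup>2 + (norm y)\<^sup>2) / 2"
    using sum_squares_bound[of "norm x" "norm y"] by simp
  finally show ?thesis .
qed

text \<open>
  In an orthonormal frame \<open>e, f\<close> of the triangle, the inequality reduces to
  \<open>L h \<bullet> (L h - h) \<ge> (\<bar>L h\<bar>\<^sup>2 - 1) / 2\<close> for \<open>h = e\<close> and \<open>h = f\<close>, which is \<open>0 \<le> \<bar>L h - h\<bar>\<^sup>2\<close>, and
  \<open>\<bar>L e \<times> L f\<bar> \<le> (\<bar>L e\<bar>\<^sup>2 + \<bar>L f\<bar>\<^sup>2) / 2\<close>, which is an equality for conformal maps.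
\<close>

lemma element_area_increment:
  fixes X v :: "real^3 \<Rightarrow> real^3"
  assumes \<sigma>: "2 simplex \<sigma>" and X\<sigma>: "2 simplex (X ` \<sigma>)"
    and L: "linear L" "\<And>y. y \<in> \<sigma> \<Longrightarrow> X y = L y + d"
    and "\<tau> > 0" and v: "\<And>y. X y = \<tau> *\<^sub>R v y + y"
  shows "tri_area (X ` \<sigma>) - tri_area \<sigma> \<le>
    \<tau> * tri_integral \<sigma> (\<lambda>x. \<Sum>i\<in>UNIV. tgrad \<sigma> (\<lambda>y. X y $ i) x \<bullet> tgrad \<sigma> (\<lambda>y. v y $ i) x)"
proof -
  obtain a b c where hull: "\<sigma> = convex hull {a, b, c}"
    using corners_hull[OF \<sigma>] by (metis prod_cases3)
  obtain e f \<alpha> \<beta> \<gamma> where orth: "norm e = 1" "norm f = 1" "e \<bullet> f = 0"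
    and ef: "b - a = \<gamma> *\<^sub>R e" "c - a = \<alpha> *\<^sub>R e + \<beta> *\<^sub>R f" "\<gamma> \<noteq> 0" "\<beta> \<noteq> 0"
    using orthonormal_frame[OF cross3_edges_nonzero] \<sigma> hull by metis
  \<comment> \<open>The linear part of \<open>v\<close>.\<close>
  define B where "B h = (1 / \<tau>) *\<^sub>R (L h - h)" for h
  have "linear B" unfolding B_def
    by (intro linear_compose_scale_right linear_compose_sub L(1) linear_id[unfolded id_def])
  have vB: "v y = B y + (1 / \<tau>) *\<^sub>R d" if "y \<in> \<sigma>" for y
  proof -
    have "v y = (1 / \<tau>) *\<^sub>R (X y - y)" using v[of y] \<open>\<tau> > 0\<close> by simp
    then show ?thesis using L(2)[OF that] by (simp add: B_def algebra_simps)
  qed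
  have comp: "linear (\<lambda>h. K h $ i)" if "linear K" for K :: "real^3 \<Rightarrow> real^3" and i
    by (auto intro!: linearI simp: linear_add[OF that] linear_scale[OF that])
  have LB: "(\<Sum>i\<in>UNIV. tgrad \<sigma> (\<lambda>y. X y $ i) x \<bullet> tgrad \<sigma> (\<lambda>y. v y $ i) x) =
      L e \<bullet> B e + L f \<bullet> B f" if "x \<in> \<sigma>" for x
  proof -
    have x: "x \<in> convex hull {a, b, c}" using that hull by simp
    have 1: "e \<bullet> e = 1" "f \<bullet> f = 1" "f \<bullet> e = 0"
      using orth by (simp_all add: norm_eq_1 inner_commute)
    have tX: "tgrad \<sigma> (\<lambda>y. X y $ i) x = (L e $ i) *\<^sub>R e + (L f $ i) *\<^sub>R f" for i
      unfolding hull by (rule tgrad_affine[OF x ef orth comp[OF L(1)], of _ _ "d $ i"])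
        (simp add: L(2) hull)
    have tv: "tgrad \<sigma> (\<lambda>y. v y $ i) x = (B e $ i) *\<^sub>R e + (B f $ i) *\<^sub>R f" for i
      unfolding hull by (rule tgrad_affine[OF x ef orth comp[OF \<open>linear B\<close>], of _ _ "((1 / \<tau>) *\<^sub>R d) $ i"])
        (simp add: vB hull)
    have "(r *\<^sub>R e + s *\<^sub>R f) \<bullet> (r' *\<^sub>R e + s' *\<^sub>R f) = r * r' + s * s'" for r s r' s'
      by (simp add: inner_add_left inner_add_right 1 orth(3))
    then show ?thesis unfolding tX tv by (simp add: inner_vec_def sum.distrib)
  qed
  have integral: "tri_integral \<sigma> (\<lambda>x. \<Sum>i\<in>UNIV. tgrad \<sigma> (\<lambda>y. X y $ i) x \<bullet> tgrad \<sigma> (\<lambda>y. v y $ i) x)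
      = tri_area \<sigma> * (L e \<bullet> B e + L f \<bullet> B f)"
    by (rule tri_integral_const[OF \<sigma> LB])
  have area: "tri_area \<sigma> = \<bar>\<gamma> * \<beta>\<bar> / 2"
  proof -
    have "(norm (cross3 e f))\<^sup>2 = 1" using norm_cross_dot[of e f] orth by simp
    then have "norm (cross3 e f) = 1" by (simp add: power2_eq_1_iff) (smt (verit) norm_ge_zero)
    then show ?thesis
      using tri_area_hull[of a b c] \<sigma> hull
      by (simp add: ef(1,2) cross_mult_left cross_mult_right cross_add_right abs_mult)
  qed
  have X\<sigma>_hull: "X ` \<sigma> = convex hull {X a, X b, X c}"
  proof -
    have "X ` \<sigma> = (\<lambda>y. d + y) ` L ` \<sigma>" using L(2) by (force simp: image_image)
    also have "\<dots> = convex hull ((\<lambda>y. d + y) ` L ` {a, b, c})"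
      unfolding hull by (simp only: convex_hull_linear_image[OF L(1)] convex_hull_translation)
    also have "(\<lambda>y. d + y) ` L ` {a, b, c} = {X a, X b, X c}"
      using L(2) hull by (auto simp: hull_inc add.commute)
    finally show ?thesis .
  qed
  have areaX: "tri_area (X ` \<sigma>) = tri_area \<sigma> * norm (cross3 (L e) (L f))"
  proof -
    have in_\<sigma>: "a \<in> \<sigma>" "b \<in> \<sigma>" "c \<in> \<sigma>" unfolding hull by (auto intro: hull_inc)
    have "X b - X a = L (b - a)" "X c - X a = L (c - a)"
      using in_\<sigma> by (simp_all add: L(2) linear_diff[OF L(1)])
    then have "X b - X a = \<gamma> *\<^sub>R L e" "X c - X a = \<alpha> *\<^sub>R L e + \<beta> *\<^sub>R L f"
      by (simp_all only: ef linear_add[OF L(1)] linear_scale[OF L(1)])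
    then show ?thesis
      using tri_area_hull[of "X a" "X b" "X c"] X\<sigma> unfolding X\<sigma>_hull area
      by (simp add: cross_mult_left cross_mult_right cross_add_right abs_mult)
  qed
  have half: "(norm (L h))\<^sup>2 / 2 - 1 / 2 \<le> \<tau> * (L h \<bullet> B h)" if "norm h = 1" for h
  proof -
    have "0 \<le> (norm (L h - h))\<^sup>2" by simp
    then have "(norm (L h))\<^sup>2 / 2 - (norm h)\<^sup>2 / 2 \<le> L h \<bullet> (L h - h)"
      by (simp add: power2_norm_eq_inner inner_simps inner_commute)
    then show ?thesis using that \<open>\<tau> > 0\<close> by (simp add: B_def)
  qed
  have "norm (cross3 (L e) (L f)) - 1 \<le> \<tau> * (L e \<bullet> B e + L f \<bullet> B f)"
    using norm_cross3_le[of "L e" "L f"] half[OF orth(1)] half[OF orth(2)]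
    by (simp add: algebra_simps)
  from mult_left_mono[OF this tri_area_nonneg[of \<sigma>]] show ?thesis
    unfolding integral areaX by (simp add: algebra_simps)
qed

section \<open>The boundary term as a change of substrate area\<close>

text \<open>
  Pairing the edge normals of one polygon with the edge midpoints of another is symmetric in the two
  polygons up to summation by parts, that is, edge by edge up to a difference of values at the end
  points. The term in the last two lines collects this difference and the one between
  \<open>edge_area\<close> and the antisymmetric summand \<open>(p $ 1 * q $ 2 - q $ 1 * p $ 2) / 2\<close>. It has the form
  \<open>G q - G p\<close>, so it cancels around a closed polygon.
\<close>

lemma telescoped_edge_area:
  assumes p: "p' = p + \<tau> *\<^sub>R vp" and q: "q' = q + \<tau> *\<^sub>R vq"
  shows "\<tau> * (cross3 ((q - p) + (q' - p')) e3 \<bullet> (vp + vq)) / 4 =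
    edge_area p' q' - edge_area p q
    + ((q $ 2 * q' $ 1 - q $ 1 * q' $ 2 + q' $ 1 * q' $ 2 - q $ 1 * q $ 2) / 2
       - (p $ 2 * p' $ 1 - p $ 1 * p' $ 2 + p' $ 1 * p' $ 2 - p $ 1 * p $ 2) / 2)"
  unfolding p q edge_area_def
  by (simp add: cross3_def inner_vec_def sum_3 axis_def field_simps)

lemma arc_pt_derivative:
  assumes "p \<noteq> q" and s: "s \<in> {0..dist p q}"
    and X: "\<And>t. t \<in> {0..1} \<Longrightarrow> X (p + t *\<^sub>R (q - p)) = X p + t *\<^sub>R (X q - X p)"
  shows "ds X p q s = (X q - X p) /\<^sub>R dist p q"
proof -
  have eq: "X (arc_pt p q r) = X p + (r / dist p q) *\<^sub>R (X q - X p)" if "r \<in> {0..dist p q}" for r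
    unfolding arc_pt_def using that assms(1) by (intro X) auto
  have "((\<lambda>r. X p + (r / dist p q) *\<^sub>R (X q - X p)) has_vector_derivative
      (X q - X p) /\<^sub>R dist p q) (at s within {0..dist p q})"
    unfolding has_vector_derivative_def
    by (auto intro!: derivative_eq_intros simp: divide_inverse)
  then have "((\<lambda>r. X (arc_pt p q r)) has_vector_derivative
      (X q - X p) /\<^sub>R dist p q) (at s within {0..dist p q})"
    by (rule has_vector_derivative_transform[OF s, rotated]) (simp add: eq)
  then show ?thesis unfolding ds_def
    by (rule vector_derivative_within_closed_interval[rotated 2]) (use assms in auto)
qed

text \<open>
  On an edge the midpoint normal is constant and the velocity is affine, so the integral is the
  trapezoidal value; the length of the edge cancels against the normalisation of the tangent.
\<close>

lemma edge_integral:
  fixes X v :: "real^3 \<Rightarrow> real^3"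
  assumes "p \<noteq> q" and Xv: "\<And>x. X x = x + \<tau> *\<^sub>R v x"
    and v: "\<And>t. t \<in> {0..1} \<Longrightarrow> v (p + t *\<^sub>R (q - p)) = v p + t *\<^sub>R (v q - v p)"
  shows "integral {0..dist p q} (\<lambda>s. k * (mid_normal X p q s \<bullet> v (arc_pt p q s))) =
    k * (cross3 ((q - p) + (X q - X p)) e3 \<bullet> (v p + v q)) / 4"
proof -
  define D where "D = dist p q"
  have D: "D > 0" using assms(1) by (simp add: D_def)
  have X: "X (p + t *\<^sub>R (q - p)) = X p + t *\<^sub>R (X q - X p)" if "t \<in> {0..1}" for t
    unfolding Xv v[OF that] by (simp add: algebra_simps)
  define N where "N = cross3 ((q - p) + (X q - X p)) e3"
  have N: "mid_normal X p q s = (1 / (2 * D)) *\<^sub>R N" if "s \<in> {0..D}" for s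
  proof -
    have "ds X p q s = (X q - X p) /\<^sub>R D" "ds id p q s = (q - p) /\<^sub>R D"
      using arc_pt_derivative[OF assms(1) that[unfolded D_def] X]
        arc_pt_derivative[OF assms(1) that[unfolded D_def], of id] by (simp_all add: D_def)
    moreover have "(1/2) *\<^sub>R (a /\<^sub>R D + b /\<^sub>R D) = (1 / (2 * D)) *\<^sub>R (a + b)" for a b :: "real^3"
      by (simp add: scaleR_right_distrib inverse_eq_divide)
    ultimately have "(1/2) *\<^sub>R (ds id p q s + ds X p q s) = (1 / (2 * D)) *\<^sub>R ((q - p) + (X q - X p))"
      by simp
    then show ?thesis unfolding mid_normal_def N_def by (simp only: cross_mult_left)
  qed
  have affine: "integral {0..D} (\<lambda>s. m + n * s) = m * D + n * (D\<^sup>2 / 2)" for m n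
  proof (rule integral_unique)
    let ?F = "\<lambda>s. m * s + n * (s\<^sup>2 / 2)"
    have "((\<lambda>s. m + n * s) has_integral ?F D - ?F 0) {0..D}"
      using D by (intro fundamental_theorem_of_calculus)
        (auto intro!: derivative_eq_intros simp flip: has_real_derivative_iff_has_vector_derivative)
    then show "((\<lambda>s. m + n * s) has_integral m * D + n * (D\<^sup>2 / 2)) {0..D}" by simp
  qed
  have "k * (mid_normal X p q s \<bullet> v (arc_pt p q s)) =
      k / (2 * D) * (N \<bullet> v p) + k / (2 * D\<^sup>2) * (N \<bullet> (v q - v p)) * s" if s: "s \<in> {0..D}" for s
  proof -
    have va: "v (arc_pt p q s) = v p + (s / D) *\<^sub>R (v q - v p)"
      unfolding arc_pt_def D_def[symmetric] using s D by (intro v) auto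
    show ?thesis unfolding N[OF s] va inner_add_right inner_scaleR_left inner_scaleR_right
      using D by (simp add: field_simps power2_eq_square)
  qed
  then have "integral {0..D} (\<lambda>s. k * (mid_normal X p q s \<bullet> v (arc_pt p q s))) =
      integral {0..D} (\<lambda>s. k / (2 * D) * (N \<bullet> v p) + k / (2 * D\<^sup>2) * (N \<bullet> (v q - v p)) * s)"
    by (rule integral_cong)
  also have "\<dots> = k / 2 * (N \<bullet> v p) + k / 4 * (N \<bullet> (v q - v p))"
    unfolding affine using D by (simp add: power2_eq_square)
  also have "\<dots> = k * (N \<bullet> (v p + v q)) / 4" by (simp add: inner_simps field_simps)
  finally show ?thesis by (simp add: D_def N_def)
qed

lemma boundary_work:
  fixes X v :: "real^3 \<Rightarrow> real^3"
  assumes M: "polyhedral_surface M" and M': "polyhedral_surface M'"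
    and Xv: "\<And>x. X x = x + \<tau> *\<^sub>R v x"
    and verts: "bverts M' = map X (bverts M)"
    and v: "\<And>\<sigma>. \<sigma> \<in> tris M \<Longrightarrow> \<exists>L d. linear L \<and> (\<forall>x\<in>\<sigma>. v x = L x + d)"
  shows "\<tau> * bd_integral M (\<lambda>p q s. k * (mid_normal X p q s \<bullet> v (arc_pt p q s))) =
    k * (measure lebesgue (substrate_region M') - measure lebesgue (substrate_region M))"
proof -
  \<comment> \<open>The vertex function of \<open>telescoped_edge_area\<close>.\<close>
  define G where "G x = (x $ 2 * X x $ 1 - x $ 1 * X x $ 2 + X x $ 1 * X x $ 2 - x $ 1 * x $ 2) / 2" for x
  have edge: "\<tau> * integral {0..dist p q} (\<lambda>s. k * (mid_normal X p q s \<bullet> v (arc_pt p q s))) =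
      k * (edge_area (X p) (X q) - edge_area p q + (G q - G p))"
    if pq: "(p, q) \<in> set (bedges M)" for p q
  proof -
    obtain \<sigma> where \<sigma>: "\<sigma> \<in> tris M" "closed_segment p q \<subseteq> \<sigma>"
      using polyhedral_bedges(1)[OF M pq] by blast
    obtain L d where L: "linear L" "\<And>x. x \<in> \<sigma> \<Longrightarrow> v x = L x + d" using v[OF \<sigma>(1)] by blast
    have seg: "v (p + t *\<^sub>R (q - p)) = v p + t *\<^sub>R (v q - v p)" if "t \<in> {0..1}" for t
    proof -
      have "p + t *\<^sub>R (q - p) = (1 - t) *\<^sub>R p + t *\<^sub>R q" by (simp add: algebra_simps)
      then have "p + t *\<^sub>R (q - p) \<in> closed_segment p q" using that by (auto simp: in_segment)
      then have "p + t *\<^sub>R (q - p) \<in> \<sigma>" "p \<in> \<sigma>" "q \<in> \<sigma>" using \<sigma>(2) by auto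
      then show ?thesis
        by (simp add: L linear_add[OF L(1)] linear_diff[OF L(1)] linear_scale[OF L(1)])
    qed
    have "integral {0..dist p q} (\<lambda>s. k * (mid_normal X p q s \<bullet> v (arc_pt p q s))) =
        k * (cross3 ((q - p) + (X q - X p)) e3 \<bullet> (v p + v q)) / 4"
      by (rule edge_integral[OF polyhedral_bedges(2)[OF M pq] Xv seg])
    then have "\<tau> * integral {0..dist p q} (\<lambda>s. k * (mid_normal X p q s \<bullet> v (arc_pt p q s))) =
        k * (\<tau> * (cross3 ((q - p) + (X q - X p)) e3 \<bullet> (v p + v q)) / 4)"
      by (simp only: mult.left_commute times_divide_eq_right)
    then show ?thesis
      unfolding telescoped_edge_area[OF Xv Xv] G_def .
  qed
  have "\<tau> * bd_integral M (\<lambda>p q s. k * (mid_normal X p q s \<bullet> v (arc_pt p q s))) =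
      (\<Sum>(p, q)\<leftarrow>bedges M. \<tau> * integral {0..dist p q} (\<lambda>s. k * (mid_normal X p q s \<bullet> v (arc_pt p q s))))"
    unfolding bd_integral_def by (simp add: sum_list_const_mult case_prod_unfold)
  also have "\<dots> = (\<Sum>(p, q)\<leftarrow>bedges M. k * (edge_area (X p) (X q) - edge_area p q + (G q - G p)))"
    by (rule arg_cong[where f = sum_list], rule map_cong[OF refl])
      (simp only: case_prod_unfold, rule edge, simp)
  also have "\<dots> = k * ((\<Sum>(p, q)\<leftarrow>bedges M. edge_area (X p) (X q))
      - (\<Sum>(p, q)\<leftarrow>bedges M. edge_area p q) + (\<Sum>(p, q)\<leftarrow>bedges M. G q - G p))"
    by (simp add: sum_list_const_mult sum_list_addf sum_list_subtractf case_prod_unfold)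
  also have "(\<Sum>(p, q)\<leftarrow>bedges M. edge_area (X p) (X q)) = (\<Sum>(p, q)\<leftarrow>bedges M'. edge_area p q)"
    unfolding bedges_def verts rotate1_map zip_map_map by (simp add: case_prod_unfold o_def)
  finally show ?thesis
    by (simp add: substrate_area[OF M] substrate_area[OF M'] sum_list_bedges_telescope)
qed

section \<open>Energy decrease\<close>

lemma S_h_vec_affine:
  assumes "v \<in> S_h_vec M" "\<sigma> \<in> tris M"
  shows "\<exists>L d. linear L \<and> (\<forall>x\<in>\<sigma>. v x = L x + d)"
proof -
  have "\<forall>i. \<exists>A b. linear A \<and> (\<forall>x\<in>\<sigma>. v x $ i = A x + b)"
    using assms unfolding S_h_vec_def S_h_def by blast
  then obtain A b where A: "\<And>i. linear (A i)" "\<And>i x. x \<in> \<sigma> \<Longrightarrow> v x $ i = A i x + b i"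
    by metis
  have "linear (\<lambda>x. \<chi> i. A i x)"
    by (rule linearI) (simp_all add: vec_eq_iff linear_add[OF A(1)] linear_scale[OF A(1)])
  moreover have "v x = (\<chi> i. A i x) + (\<chi> i. b i)" if "x \<in> \<sigma>" for x
    using A(2)[OF that] by (simp add: vec_eq_iff)
  ultimately show ?thesis by blast
qed

lemma X_h_subset_S_h_vec: "X_h M \<subseteq> S_h_vec M"
  by (auto simp: X_h_def S_h_vec_def S_h0_def forall_3)

text \<open>
  Every point of a triangle is a limit point of its relative interior, since the latter is
  connected, dense in the triangle and not a single point.
\<close>

lemma vertex_limit:
  fixes g :: "real^3 \<Rightarrow> real"
  assumes \<sigma>: "2 simplex \<sigma>" and q: "q extreme_point_of \<sigma>" and g: "continuous_on \<sigma> g"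
  shows "Lim (at q within rel_interior \<sigma>) g = g q"
proof (rule tendsto_Lim)
  have "convex \<sigma>" "closed \<sigma>"
    using \<sigma> by (auto simp: simplex_def dest!: aff_independent_finite
        intro!: compact_imp_closed finite_imp_compact_convex_hull)
  have "q \<in> \<sigma>" using q by (simp add: extreme_point_of_def)
  then have q_cl: "q \<in> closure (rel_interior \<sigma>)"
    using convex_closure_rel_interior[OF \<open>convex \<sigma>\<close>] closure_subset by blast
  have "rel_interior \<sigma> \<noteq> {x}" for x
  proof
    assume "rel_interior \<sigma> = {x}"
    then have "\<sigma> = {x}"
      using convex_closure_rel_interior[OF \<open>convex \<sigma>\<close>] \<open>closed \<sigma>\<close> by simp
    then show False using aff_dim_simplex[OF \<sigma>] by simp
  qed
  then have "q islimpt rel_interior \<sigma>"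
    using q_cl connected_imp_perfect[of "rel_interior \<sigma>" q]
      convex_connected[OF convex_rel_interior[OF \<open>convex \<sigma>\<close>]]
    unfolding closure_def by blast
  then show "at q within rel_interior \<sigma> \<noteq> bot" by (simp add: trivial_limit_within)
  have "(g \<longlongrightarrow> g q) (at q within \<sigma>)" using g \<open>q \<in> \<sigma>\<close> by (simp add: continuous_on_def)
  then show "(g \<longlongrightarrow> g q) (at q within rel_interior \<sigma>)"
    by (rule tendsto_within_subset) (rule rel_interior_subset)
qed

text \<open>
  This is where the values of the lumped product at the vertices matter: on a continuous
  field the one-sided limits are squared norms. The sign is needed because \<open>lump_norm\<close> is a square root,
  and \<open>sqrt\<close> is negative on negative numbers.
\<close>

lemma lump_self_nonneg:
  assumes M: "\<forall>\<sigma>\<in>tris M. 2 simplex \<sigma>" and T: "T \<in> S_h_vec M"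
  shows "0 \<le> lump M T T"
proof -
  have "0 \<le> Lim (at q within rel_interior \<sigma>) (\<lambda>x. T x \<bullet> T x)"
    if "\<sigma> \<in> tris M" "q extreme_point_of \<sigma>" for \<sigma> q
  proof -
    obtain L d where L: "linear L" "\<And>x. x \<in> \<sigma> \<Longrightarrow> T x = L x + d"
      using S_h_vec_affine[OF T \<open>\<sigma> \<in> tris M\<close>] by blast
    have "continuous_on \<sigma> (\<lambda>x. L x + d)"
      by (intro continuous_on_add linear_continuous_on L(1)[unfolded linear_conv_bounded_linear]
          continuous_on_const)
    then have "continuous_on \<sigma> T" using L(2) by (simp cong: continuous_on_cong)
    then have "Lim (at q within rel_interior \<sigma>) (\<lambda>x. T x \<bullet> T x) = T q \<bullet> T q"
      using M that by (intro vertex_limit continuous_on_inner) auto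
    then show ?thesis by simp
  qed
  then show ?thesis unfolding lump_def
    by (auto intro!: mult_nonneg_nonneg sum_nonneg tri_area_nonneg)
qed

text \<open>
  Triangles of \<open>M\<close> might share an image; then the sum over \<open>tris M'\<close> has fewer terms than
  the sum over \<open>tris M\<close>, and the inequality only improves.
\<close>

lemma area_increment:
  fixes X v :: "real^3 \<Rightarrow> real^3"
  assumes M: "polyhedral_surface M" and M': "polyhedral_surface M'"
    and "\<tau> > 0" and X: "\<And>x. X x = \<tau> *\<^sub>R v x + x" and v: "v \<in> S_h_vec M"
    and image: "tris M' = (\<lambda>\<sigma>. X ` \<sigma>) ` tris M"
  shows "surf_area M' - surf_area M \<le> \<tau> * grad_dot_vec M X v"
proof -
  have fin: "finite (tris M)" using M by (simp add: polyhedral_surface_def triangulation_def)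
  have incr: "tri_area (X ` \<sigma>) - tri_area \<sigma> \<le>
    \<tau> * tri_integral \<sigma> (\<lambda>x. \<Sum>i\<in>UNIV. tgrad \<sigma> (\<lambda>y. X y $ i) x \<bullet> tgrad \<sigma> (\<lambda>y. v y $ i) x)"
    if \<sigma>: "\<sigma> \<in> tris M" for \<sigma>
  proof -
    obtain L d where L: "linear L" "\<And>x. x \<in> \<sigma> \<Longrightarrow> v x = L x + d"
      using S_h_vec_affine[OF v \<sigma>] by blast
    show ?thesis
    proof (rule element_area_increment[where L = "\<lambda>x. \<tau> *\<^sub>R L x + x"])
      show "linear (\<lambda>x. \<tau> *\<^sub>R L x + x)"
        by (intro linear_compose_add linear_compose_scale_right L(1) linear_id[unfolded id_def])
      show "X y = \<tau> *\<^sub>R L y + y + \<tau> *\<^sub>R d" if "y \<in> \<sigma>" for y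
        by (simp add: X L(2)[OF that] scaleR_add_right)
      show "2 simplex \<sigma>" using M \<sigma> by (simp add: polyhedral_surface_def)
      show "2 simplex (X ` \<sigma>)" using M' \<sigma> image by (simp add: polyhedral_surface_def)
    qed (use \<open>\<tau> > 0\<close> X in auto)
  qed
  have "surf_area M' \<le> (\<Sum>\<sigma>\<in>tris M. tri_area (X ` \<sigma>))"
    using sum_image_le[OF fin, of tri_area "\<lambda>\<sigma>. X ` \<sigma>"] tri_area_nonneg
    by (simp add: surf_area_def image o_def)
  then have "surf_area M' - surf_area M \<le> (\<Sum>\<sigma>\<in>tris M. tri_area (X ` \<sigma>) - tri_area \<sigma>)"
    by (simp add: surf_area_def sum_subtractf)
  also have "\<dots> \<le> \<tau> * grad_dot_vec M X v"
    unfolding grad_dot_vec_def surf_integral_def sum_distrib_left by (intro sum_mono incr)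
  finally show ?thesis .
qed

text \<open>
  Tested with \<open>v\<close> and \<open>lam\<close>, the first two equations contain the same lumped pairing, so it can be
  eliminated, and the third fixes the sign of \<open>c * lump M T v\<close>.
\<close>

lemma energy_step:
  fixes X v T :: "real^3 \<Rightarrow> real^3" and lam :: "real^3 \<Rightarrow> real"
  assumes "\<tau> > 0" "\<alpha> > 0"
    and M: "polyhedral_surface M" and M': "polyhedral_surface M'"
    and X: "\<And>x. X x = x + \<tau> *\<^sub>R v x"
    and image: "tris M' = (\<lambda>\<sigma>. X ` \<sigma>) ` tris M" "bverts M' = map X (bverts M)"
    and T: "T \<in> S_h_vec M" and v: "v \<in> X_h M"
    and momentum: "grad_dot_vec M (\<lambda>x. \<tau> *\<^sub>R v x + x) v
        - lump M (\<lambda>x. lam x *\<^sub>R n_h M x) v - c * lump M T v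
      = bd_integral M (\<lambda>p q s. cos \<theta> * (mid_normal X p q s \<bullet> v (arc_pt p q s)))"
    and diffusion: "lump M (\<lambda>x. v x \<bullet> n_h M x) lam + grad_dot M lam lam = 0"
    and multiplier: "lump M v T + \<alpha> * c * lump_norm M T = 0"
  shows "surf_energy \<theta> M' \<le> surf_energy \<theta> M"
proof -
  have vS: "v \<in> S_h_vec M" using v X_h_subset_S_h_vec by blast
  have lam_n: "lump M (\<lambda>x. lam x *\<^sub>R n_h M x) v = lump M (\<lambda>x. v x \<bullet> n_h M x) lam"
    unfolding lump_def by (simp add: inner_commute mult.commute)
  have lump_sym: "lump M T v = lump M v T" unfolding lump_def by (simp add: inner_commute)
  have "0 \<le> lump_norm M T"
    using lump_self_nonneg[of M T] M T by (simp add: lump_norm_def polyhedral_surface_def)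
  then have "0 \<le> \<alpha> * c\<^sup>2 * lump_norm M T" using \<open>\<alpha> > 0\<close> by simp
  moreover have "- (c * lump M T v) = \<alpha> * c\<^sup>2 * lump_norm M T"
  proof -
    have "lump M v T = - (\<alpha> * c * lump_norm M T)" using multiplier by linarith
    then show ?thesis unfolding lump_sym by (simp add: power2_eq_square)
  qed
  moreover have "0 \<le> grad_dot M lam lam" unfolding grad_dot_def surf_integral_def
    by (intro sum_nonneg tri_integral_nonneg) simp
  ultimately have "grad_dot_vec M (\<lambda>x. \<tau> *\<^sub>R v x + x) v
      \<le> bd_integral M (\<lambda>p q s. cos \<theta> * (mid_normal X p q s \<bullet> v (arc_pt p q s)))"
    using momentum diffusion lam_n by linarith
  moreover have "(\<lambda>x. \<tau> *\<^sub>R v x + x) = X" using X by (simp add: fun_eq_iff add.commute)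
  ultimately have "\<tau> * grad_dot_vec M X v
      \<le> \<tau> * bd_integral M (\<lambda>p q s. cos \<theta> * (mid_normal X p q s \<bullet> v (arc_pt p q s)))"
    using \<open>\<tau> > 0\<close> by simp
  also have "\<dots> = cos \<theta> * (measure lebesgue (substrate_region M') - measure lebesgue (substrate_region M))"
    by (rule boundary_work[OF M M' X image(2) S_h_vec_affine[OF vS]])
  finally have "\<tau> * grad_dot_vec M X v \<le> cos \<theta> *
      (measure lebesgue (substrate_region M') - measure lebesgue (substrate_region M))" .
  moreover have "surf_area M' - surf_area M \<le> \<tau> * grad_dot_vec M X v"
    by (rule area_increment[OF M M' \<open>\<tau> > 0\<close> _ vS image(1)]) (simp add: X add.commute)
  ultimately show ?thesis by (simp add: surf_energy_def right_diff_distrib)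
qed

theorem theorem3p6:
  fixes \<tau> \<alpha> \<theta> :: real and N :: nat
    and \<Gamma> :: "nat \<Rightarrow> polysurf"
    and X v T :: "nat \<Rightarrow> real^3 \<Rightarrow> real^3"
    and lam :: "nat \<Rightarrow> real^3 \<Rightarrow> real"
    and c :: "nat \<Rightarrow> real"
  assumes "\<tau> > 0" and "\<alpha> > 0"
    and "\<forall>m\<le>N. polyhedral_surface (\<Gamma> m)"
    and "\<forall>m\<in>{1..N}. \<forall>x. X m x = x + \<tau> *\<^sub>R v m x"
    and "\<forall>m\<in>{1..N}. tris (\<Gamma> m) = (\<lambda>\<sigma>. X m ` \<sigma>) ` tris (\<Gamma> (m - 1))
           \<and> bverts (\<Gamma> m) = map (X m) (bverts (\<Gamma> (m - 1)))"
    and "\<forall>m\<in>{1..N}. is_T_h (\<Gamma> (m - 1)) \<theta> (T (m - 1))"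
    and "\<forall>m\<in>{1..N}. v m \<in> X_h (\<Gamma> (m - 1)) \<and> lam m \<in> S_h (\<Gamma> (m - 1))"
    and "\<forall>m\<in>{1..N}. \<forall>\<eta>\<in>X_h (\<Gamma> (m - 1)).
           grad_dot_vec (\<Gamma> (m - 1)) (\<lambda>x. \<tau> *\<^sub>R v m x + x) \<eta>
             - lump (\<Gamma> (m - 1)) (\<lambda>x. lam m x *\<^sub>R n_h (\<Gamma> (m - 1)) x) \<eta>
             - c m * lump (\<Gamma> (m - 1)) (T (m - 1)) \<eta>
           = bd_integral (\<Gamma> (m - 1))
               (\<lambda>p q s. cos \<theta> * (mid_normal (X m) p q s \<bullet> \<eta> (arc_pt p q s)))"
    and "\<forall>m\<in>{1..N}. \<forall>\<xi>\<in>S_h (\<Gamma> (m - 1)).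
           lump (\<Gamma> (m - 1)) (\<lambda>x. v m x \<bullet> n_h (\<Gamma> (m - 1)) x) \<xi>
             + grad_dot (\<Gamma> (m - 1)) (lam m) \<xi> = 0"
    and "\<forall>m\<in>{1..N}.
           lump (\<Gamma> (m - 1)) (v m) (T (m - 1))
             + \<alpha> * c m * lump_norm (\<Gamma> (m - 1)) (T (m - 1)) = 0"
  shows "\<forall>m\<in>{1..N}. surf_energy \<theta> (\<Gamma> m) \<le> surf_energy \<theta> (\<Gamma> (m - 1))"
proof
  fix m assume m: "m \<in> {1..N}"
  then have le: "m \<le> N" "m - 1 \<le> N" by auto
  have v: "v m \<in> X_h (\<Gamma> (m - 1))" and lam: "lam m \<in> S_h (\<Gamma> (m - 1))" using assms(7) m by auto
  have T: "T (m - 1) \<in> S_h_vec (\<Gamma> (m - 1))" using assms(6) m by (simp add: is_T_h_def)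
  show "surf_energy \<theta> (\<Gamma> m) \<le> surf_energy \<theta> (\<Gamma> (m - 1))"
  proof (rule energy_step)
    show "polyhedral_surface (\<Gamma> (m - 1))" "polyhedral_surface (\<Gamma> m)" using assms(3) le by auto
    show "X m x = x + \<tau> *\<^sub>R v m x" for x using assms(4) m by blast
    show "tris (\<Gamma> m) = (\<lambda>\<sigma>. X m ` \<sigma>) ` tris (\<Gamma> (m - 1))"
      "bverts (\<Gamma> m) = map (X m) (bverts (\<Gamma> (m - 1)))" using assms(5) m by blast+
    show "grad_dot_vec (\<Gamma> (m - 1)) (\<lambda>x. \<tau> *\<^sub>R v m x + x) (v m)
        - lump (\<Gamma> (m - 1)) (\<lambda>x. lam m x *\<^sub>R n_h (\<Gamma> (m - 1)) x) (v m)
        - c m * lump (\<Gamma> (m - 1)) (T (m - 1)) (v m)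
      = bd_integral (\<Gamma> (m - 1))
          (\<lambda>p q s. cos \<theta> * (mid_normal (X m) p q s \<bullet> v m (arc_pt p q s)))"
      using assms(8) m v by blast
    show "lump (\<Gamma> (m - 1)) (\<lambda>x. v m x \<bullet> n_h (\<Gamma> (m - 1)) x) (lam m)
        + grad_dot (\<Gamma> (m - 1)) (lam m) (lam m) = 0"
      using assms(9) m lam by blast
    show "lump (\<Gamma> (m - 1)) (v m) (T (m - 1))
        + \<alpha> * c m * lump_norm (\<Gamma> (m - 1)) (T (m - 1)) = 0"
      using assms(10) m by blast
  qed (use assms(1,2) T v in auto)
qed

end
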